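(* Let $\mathbb{V}=\bigotimes_{k=1}^p\mathbb{V}^k$ be a finite-dimensional tensor space of functions on $\mathbb{R}^d$ with basis $\mathbf{\Psi}=\bigotimes_{k=1}^p\psi_k$. Let $x_1,\dots,x_m\in\mathbb{R}^d$ be data points such that, for prescribed ranks $\mathbf{r}=[r_1,\dots,r_p]$, the empirical multi-linear spectral subspaces $\widehat{\mathbb{G}}^{:k}$, $1\le k\le p$, are well-defined. Let $\widehat{\mathbf{U}}_{X,r},\widehat{\Sigma}_{X,r},\widehat{V}_{X,r}$, with $r=r_p$, be the components of the global SVD, truncated at the ranks $\mathbf{r}$, of the transformed data tensor $\mathbf{\Psi}(X)$. Then: 1. The orthonormal part $\widehat{\mathbf{U}}_{X,r}$ provides orthonormal coefficient tensors for each of the spaces $\widehat{\mathbb{B}}^{:k}$: for $1\le k\le p$, the columns of $\widehat{\mathbf{U}}_{X,r}^{:k}\vert_k$ form an orthonormal basis of $\widehat{\mathbb{B}}^{:k}$, i.e. the entries of $(\widehat{\theta}_k)^\top=(\mathbf{\Psi}_{:k}\vert_k)^\top\,\widehat{\mathbf{U}}_{X,r}^{:k}\vert_k$ form a basis of $\widehat{\mathbb{G}}^{:k}$. 2. The remaining parts of the global SVD contain the time series of the basis of the final space $\widehat{\mathbb{G}}^{:p}$: $$\widehat{\Sigma}_{X,r}\widehat{V}_{X,r}^\top=\widehat{\theta}_p(X)=(\widehat{\mathbf{U}}_{X,r}\vert_p)^\top\,\mathbf{\Psi}(X)\vert_p .$$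
   Context: **Tensor spaces.** $\psi_k=(\psi_{k,1},\dots,\psi_{k,n_k})^\top$ are real functions on $\mathbb{R}^d$, $\mathbb{V}^k=\mathrm{span}\{\psi_{k,i}\}$, and $\mathbb{V}^{:k}=\bigotimes_{l=1}^k\mathbb{V}^l$ is the span of the pointwise products $x\mapsto\psi_{1,i_1}(x)\cdots\psi_{k,i_k}(x)$, which form a basis $\mathbf{\Psi}_{:k}$ of $\mathbb{V}^{:k}$ (assumed linearly independent); $\mathbf{\Psi}=\mathbf{\Psi}_{:p}$, $\mathbb{V}=\mathbb{V}^{:p}$. $\mathbf{\Psi}_{:k}\vert_k$ is the vector of these $n_1\cdots n_k$ products. **Tensor notation.** For a tensor $\mathbf{T}$, the mode-$k$ unfolding $\mathbf{T}\vert_k$ is the matrix whose rows are indexed by the first $k$ modes and columns by the remaining modes (one fixed consistent ordering of multi-indices is used everywhere). A tensor train with cores $\mathbf{T}^{(k)}\in\mathbb{R}^{r_{k-1}\times n_k\times r_k}$ has entries obtained by summing $\prod_k\mathbf{T}^{(k)}_{l_{k-1},i_k,l_k}$ over the shared rank indices; $\mathbf{T}^{:k}$ is the partial tensor train built from cores $1,\dots,k$, with trailing index $l_k$ left open. For a vector of functions $\theta=(\theta_1,\dots,\theta_r)^\top$, $\theta(X)\in\mathbb{R}^{r\times m}$ is the matrix with columns $\theta(x_1),\dots,\theta(x_m)$. **Transformed data tensor.** $\mathbf{\Psi}(X)\in\mathbb{R}^{n_1\times\dots\times n_p\times m}$ has entries $\mathbf{\Psi}(X)_{i_1,\dots,i_p,l}=\psi_{1,i_1}(x_l)\cdots\psi_{p,i_p}(x_l)$.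 It is represented as a tensor train with $p+1$ cores: $\mathbf{\Psi}^{(1)}(X)_{1,i,l}=\psi_{1,i}(x_l)$; $\mathbf{\Psi}^{(k)}(X)_{l,i,l'}=\delta_{l,l'}\psi_{k,i}(x_l)$ for $2\le k\le p$ with $1\le l,l'\le m$; and $\mathbf{\Psi}^{(p+1)}(X)=\mathrm{Id}_m$. **Global SVD with ranks $\mathbf{r}$.** Starting from these cores, for $k=1,\dots,p-1$: compute the SVD of $\mathbf{\Psi}^{(k)}(X)\vert_2$ (matrix with rows indexed by $(l_{k-1},i_k)$) truncated to the leading $r_k$ singular triplets, $U\Sigma V^\top$; replace $\mathbf{\Psi}^{(k)}(X)$ by $U$ reshaped to $r_{k-1}\times n_k\times r_k$; replace $\mathbf{\Psi}^{(k+1)}(X)$ by the reshaped version of $\Sigma V^\top\,\mathbf{\Psi}^{(k+1)}(X)\vert_1$. Finally, for $k=p$, compute the rank-$r_p$ truncated SVD $U\Sigma V^\top$ of $\mathbf{\Psi}^{(p)}(X)\vert_2$, replace $\mathbf{\Psi}^{(p)}(X)$ by the reshaped $U$, and set $\widehat{\Sigma}_{X,r}=\Sigma$, $\widehat{V}_{X,r}=V$, and $\widehat{\mathbf{U}}_{X,r}\in\mathbb{R}^{n_1\times\dots\times n_p\times r}$ the tensor train consisting of the final first $p$ cores. $\widehat{\mathbf{U}}_{X,r}\widehat{\Sigma}_{X,r}\widehat{V}_{X,r}^\top$ is called the global SVD. **Empirical multi-linear spectral subspaces.** For a tuple $\eta$ of functions, $\widehat{C}(\eta)=\frac1m\sum_{k=1}^m\eta(x_k)\eta(x_k)^\top$.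 Put $r_0=1$, $\widehat{\theta}_0=1$. Recursively for $k=1,\dots,p$, let $\mathbf{vec}(\widehat{\theta}_{k-1}\otimes\psi_k)$ be the vector of the $r_{k-1}n_k$ products $\widehat{\theta}_{k-1,l}\psi_{k,i}$ and let $\widehat{\sigma}_{k,1}^2\ge\widehat{\sigma}_{k,2}^2\ge\dots$ be the eigenvalues of $\widehat{C}(\mathbf{vec}(\widehat{\theta}_{k-1}\otimes\psi_k))$. If $\widehat{\sigma}_{k,r_k}>\widehat{\sigma}_{k,r_k+1}$ (with $r_k\le r_{k-1}n_k$ and the convention $\widehat{\sigma}_{k,r_{k-1}n_k+1}=0$), choose any $\widehat{U}_k\in\mathbb{R}^{r_{k-1}n_k\times r_k}$ whose columns are an orthonormal basis of the span of eigenvectors for the $r_k$ largest eigenvalues, and set $(\widehat{\theta}_k)^\top=(\mathbf{vec}(\widehat{\theta}_{k-1}\otimes\psi_k))^\top\widehat{U}_k$, $\widehat{\mathbb{G}}^{:k}=\mathrm{span}(\widehat{\theta}_k)$. The subspaces $\widehat{\mathbb{G}}^{:k}$ do not depend on the choices of $\widehat{U}_k$; they are well-defined if all gap conditions hold. $\widehat{\mathbb{B}}^{:k}\subset\mathbb{R}^{n_1\cdots n_k}$ is the space of coefficient vectors of the elements of $\widehat{\mathbb{G}}^{:k}$ with respect to $\mathbf{\Psi}_{:k}$. *)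

theory Defs
  imports
    "HOL-Library.Function_Algebras"
    "HOL-Analysis.Finite_Cartesian_Product"
    "Jordan_Normal_Form.VS_Connect"
    "Jordan_Normal_Form.Char_Poly"
begin

text \<open>
  Conventions. The modes of a tensor train are numbered from \<open>1\<close> (so that \<open>r 0 = 1\<close> makes sense);
  indices inside a mode, rank indices and data points are numbered from \<open>0\<close>.
  A vector of functions is a list of functions, so that \<open>n\<^sub>k = length (\<psi> k)\<close>, and the data
  \<open>x\<^sub>1, \<dots>, x\<^sub>m\<close> are a list \<open>X\<close>, so that \<open>m = length X\<close>.
\<close>

subsection \<open>Spaces of functions\<close>

global_interpretation fn: vector_space "\<lambda>(c::real) (f :: 'a \<Rightarrow> real) x. c * f x"
  defines fn_span = fn.span
    and fn_dependent = fn.dependent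
  by unfold_locales (auto simp: fun_eq_iff algebra_simps)

definition fn_indep :: "('a \<Rightarrow> real) list \<Rightarrow> bool" where
  "fn_indep fs \<longleftrightarrow> distinct fs \<and> \<not> fn_dependent (set fs)"

definition fn_basis :: "('a \<Rightarrow> real) list \<Rightarrow> ('a \<Rightarrow> real) set \<Rightarrow> bool" where
  "fn_basis fs G \<longleftrightarrow> fn_indep fs \<and> fn_span (set fs) = G"

text \<open>The tuple of functions \<open>\<theta>\<close> with \<open>\<theta>\<^sup>T = \<eta>\<^sup>T U\<close>, for a tuple \<open>\<eta>\<close> and a matrix \<open>U\<close>.\<close>

definition fn_mult :: "('a \<Rightarrow> real) list \<Rightarrow> real mat \<Rightarrow> ('a \<Rightarrow> real) list" where
  "fn_mult \<eta> U = map (\<lambda>j x. \<Sum>i<length \<eta>. (\<eta> ! i) x * U $$ (i, j)) [0..<dim_col U]"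

definition eval_mat :: "('a \<Rightarrow> real) list \<Rightarrow> 'a list \<Rightarrow> real mat" where
  "eval_mat \<theta> X = mat (length \<theta>) (length X) (\<lambda>(i, l). (\<theta> ! i) (X ! l))"

text \<open>Coefficient vectors of the elements of \<open>G\<close> with respect to the tuple \<open>fs\<close>.\<close>

definition coeff_space :: "('a \<Rightarrow> real) list \<Rightarrow> ('a \<Rightarrow> real) set \<Rightarrow> real Matrix.vec set" where
  "coeff_space fs G =
     {c \<in> carrier_vec (length fs). (\<lambda>x. \<Sum>i<length fs. vec_index c i * (fs ! i) x) \<in> G}"

subsection \<open>Matrices\<close>

definition vec_span :: "nat \<Rightarrow> real Matrix.vec set \<Rightarrow> real Matrix.vec set" where
  "vec_span N A = LinearCombinations.module.span class_ring (module_vec TYPE(real) N) A"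

definition vec_dependent :: "nat \<Rightarrow> real Matrix.vec set \<Rightarrow> bool" where
  "vec_dependent N A = LinearCombinations.module.lin_dep class_ring (module_vec TYPE(real) N) A"

definition orthonormal_basis :: "nat \<Rightarrow> real Matrix.vec list \<Rightarrow> real Matrix.vec set \<Rightarrow> bool" where
  "orthonormal_basis N us B \<longleftrightarrow>
     set us \<subseteq> carrier_vec N \<and>
     (\<forall>i<length us. \<forall>j<length us. us ! i \<bullet> us ! j = (if i = j then 1 else 0)) \<and>
     distinct us \<and> \<not> vec_dependent N (set us) \<and> vec_span N (set us) = B"

definition is_svd :: "real mat \<Rightarrow> real mat \<Rightarrow> real mat \<Rightarrow> real mat \<Rightarrow> bool" where
  "is_svd A U S V \<longleftrightarrow>
     (let a = dim_row A; b = dim_col A in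
        U \<in> carrier_mat a a \<and> S \<in> carrier_mat a b \<and> V \<in> carrier_mat b b \<and>
        U\<^sup>T * U = 1\<^sub>m a \<and> V\<^sup>T * V = 1\<^sub>m b \<and>
        (\<forall>i<a. \<forall>j<b. i \<noteq> j \<longrightarrow> S $$ (i, j) = 0) \<and>
        (\<forall>i<min a b. 0 \<le> S $$ (i, i)) \<and>
        (\<forall>i j. i \<le> j \<longrightarrow> j < min a b \<longrightarrow> S $$ (j, j) \<le> S $$ (i, i)) \<and>
        A = U * S * V\<^sup>T)"

text \<open>An SVD is not unique, so the truncation to \<open>r\<close> leading singular triplets is a relation.\<close>

definition truncated_svd :: "real mat \<Rightarrow> nat \<Rightarrow> real mat \<Rightarrow> real mat \<Rightarrow> real mat \<Rightarrow> bool" where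
  "truncated_svd A r U S V \<longleftrightarrow>
     r \<le> min (dim_row A) (dim_col A) \<and>
     (\<exists>U' S' V'. is_svd A U' S' V' \<and>
        U = mat (dim_row A) r (\<lambda>ij. U' $$ ij) \<and>
        S = mat r r (\<lambda>ij. S' $$ ij) \<and>
        V = mat (dim_col A) r (\<lambda>ij. V' $$ ij))"

text \<open>The real eigenvalues in decreasing order, repeated according to multiplicity.\<close>

definition eigenvalue_list :: "real mat \<Rightarrow> real list" where
  "eigenvalue_list A = rev (sorted_list_of_multiset (proots (char_poly A)))"

text \<open>
  \<open>\<sigma>\<^sub>j\<close> for \<open>j \<ge> 1\<close>, where \<open>\<sigma>\<^sub>1\<^sup>2 \<ge> \<sigma>\<^sub>2\<^sup>2 \<ge> \<dots>\<close> are the eigenvalues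
  of the positive semidefinite matrix \<open>A\<close>, and \<open>\<sigma>\<^sub>j = 0\<close> beyond the size of \<open>A\<close>.
\<close>

definition sqrt_eigenvalue :: "real mat \<Rightarrow> nat \<Rightarrow> real" where
  "sqrt_eigenvalue A j =
     (if j \<le> dim_row A then sqrt (eigenvalue_list A ! (j - 1)) else 0)"

definition spectral_gap :: "real mat \<Rightarrow> nat \<Rightarrow> bool" where
  "spectral_gap A r \<longleftrightarrow> r \<le> dim_row A \<and> sqrt_eigenvalue A r > sqrt_eigenvalue A (r + 1)"

definition leading_eigenspace :: "real mat \<Rightarrow> nat \<Rightarrow> real Matrix.vec set" where
  "leading_eigenspace A r =
     vec_span (dim_row A) {v. \<exists>e \<in> set (take r (eigenvalue_list A)). eigenvector A v e}"

subsection \<open>Tensors\<close>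

text \<open>
  A tensor with dimensions \<open>ns\<close> is a function on multi-indices, of which only the values on
  \<open>set (multi_indices ns)\<close> are meaningful. The list \<open>multi_indices ns\<close> fixes the (lexicographic)
  ordering of multi-indices.
\<close>

type_synonym tensor = "nat list \<Rightarrow> real"

definition multi_indices :: "nat list \<Rightarrow> nat list list" where
  "multi_indices ns = product_lists (map (\<lambda>n. [0..<n]) ns)"

definition unfolding_mat :: "nat list \<Rightarrow> nat \<Rightarrow> tensor \<Rightarrow> real mat" where
  "unfolding_mat ns k T =
     (let rs = multi_indices (take k ns); cs = multi_indices (drop k ns)
      in mat (length rs) (length cs) (\<lambda>(i, j). T (rs ! i @ cs ! j)))"

text \<open>
  The partial tensor train of the cores \<open>T 1, \<dots>, T k\<close>, at the multi-index
  \<open>[i\<^sub>1, \<dots>, i\<^sub>k, l\<^sub>k]\<close> with trailing rank index \<open>l\<^sub>k\<close>. The sum ranges over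
  \<open>[l\<^sub>1, \<dots>, l\<^bsub>k-1\<^esub>]\<close>, and \<open>l\<^sub>0 = 0\<close> is the only index of the first rank.
\<close>

definition partial_tt :: "(nat \<Rightarrow> nat) \<Rightarrow> (nat \<Rightarrow> tensor) \<Rightarrow> nat \<Rightarrow> tensor" where
  "partial_tt r T k ix =
     (\<Sum>ls\<leftarrow>multi_indices (map r [1..<k]).
        let l = 0 # ls @ [ix ! k]
        in \<Prod>j=1..k. T j [l ! (j - 1), ix ! (j - 1), l ! j])"

definition mode_dims :: "(nat \<Rightarrow> ('a \<Rightarrow> real) list) \<Rightarrow> nat \<Rightarrow> nat list" where
  "mode_dims \<psi> k = map (\<lambda>j. length (\<psi> j)) [1..<k + 1]"

text \<open>The vector \<open>\<Psi>\<^bsub>:k\<^esub>|\<^sub>k\<close> of the pointwise products \<open>\<psi>\<^bsub>1,i\<^sub>1\<^esub> \<cdots> \<psi>\<^bsub>k,i\<^sub>k\<^esub>\<close>.\<close>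

definition product_basis :: "(nat \<Rightarrow> ('a \<Rightarrow> real) list) \<Rightarrow> nat \<Rightarrow> ('a \<Rightarrow> real) list" where
  "product_basis \<psi> k =
     map (\<lambda>ix x. \<Prod>j=1..k. (\<psi> j ! (ix ! (j - 1))) x) (multi_indices (mode_dims \<psi> k))"

definition data_tensor :: "(nat \<Rightarrow> ('a \<Rightarrow> real) list) \<Rightarrow> nat \<Rightarrow> 'a list \<Rightarrow> tensor" where
  "data_tensor \<psi> p X ix = (\<Prod>j=1..p. (\<psi> j ! (ix ! (j - 1))) (X ! (ix ! p)))"

subsection \<open>The global SVD\<close>

text \<open>
  The cores \<open>1, \<dots>, p\<close> of the transformed data tensor. The last core, number \<open>p + 1\<close>, is the
  identity matrix of size \<open>m\<close>; it is not touched by the global SVD and hence left implicit.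
\<close>

definition data_core :: "(nat \<Rightarrow> ('a \<Rightarrow> real) list) \<Rightarrow> 'a list \<Rightarrow> nat \<Rightarrow> tensor" where
  "data_core \<psi> X k ix =
     (if k = 1 \<or> ix ! 0 = ix ! 2 then (\<psi> k ! (ix ! 1)) (X ! (ix ! 2)) else 0)"

text \<open>
  \<open>W k\<close> is the \<open>k\<close>-th core just before its own SVD is computed, that is, after the factor
  \<open>\<Sigma> V\<^sup>T\<close> of step \<open>k - 1\<close> has been absorbed, and \<open>T k\<close> is the final \<open>k\<close>-th core.
  Reshaping a matrix \<open>M\<close> to a core is expressed by saying that the unfolding of the core is \<open>M\<close>.
  The outcome of the algorithm consists of \<open>T\<close>, \<open>S\<close> and \<open>V\<close>.
\<close>

definition global_svd ::
  "(nat \<Rightarrow> ('a \<Rightarrow> real) list) \<Rightarrow> nat \<Rightarrow> (nat \<Rightarrow> nat) \<Rightarrow> 'a list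
    \<Rightarrow> (nat \<Rightarrow> tensor) \<Rightarrow> real mat \<Rightarrow> real mat \<Rightarrow> bool" where
  "global_svd \<psi> p r X T S V \<longleftrightarrow>
     (let m = length X; n = (\<lambda>k. length (\<psi> k)) in
      \<exists>W Us Ss Vs.
        W 1 = data_core \<psi> X 1 \<and>
        (\<forall>k\<in>{1..p}.
           truncated_svd (unfolding_mat [r (k - 1), n k, m] 2 (W k)) (r k) (Us k) (Ss k) (Vs k) \<and>
           unfolding_mat [r (k - 1), n k, r k] 2 (T k) = Us k) \<and>
        (\<forall>k\<in>{1..<p}.
           unfolding_mat [r k, n (k + 1), m] 1 (W (k + 1)) =
             Ss k * (Vs k)\<^sup>T * unfolding_mat [m, n (k + 1), m] 1 (data_core \<psi> X (k + 1))) \<and>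
        S = Ss p \<and> V = Vs p)"

text \<open>The unfolding \<open>U\<^bsup>:k\<^esup>|\<^sub>k\<close> of the partial tensor train with cores \<open>T 1, \<dots>, T k\<close>.\<close>

definition tt_coeffs ::
  "(nat \<Rightarrow> ('a \<Rightarrow> real) list) \<Rightarrow> (nat \<Rightarrow> nat) \<Rightarrow> (nat \<Rightarrow> tensor) \<Rightarrow> nat \<Rightarrow> real mat" where
  "tt_coeffs \<psi> r T k = unfolding_mat (mode_dims \<psi> k @ [r k]) k (partial_tt r T k)"

subsection \<open>Empirical multi-linear spectral subspaces\<close>

definition empirical_cov :: "('a \<Rightarrow> real) list \<Rightarrow> 'a list \<Rightarrow> real mat" where
  "empirical_cov \<eta> X =
     mat (length \<eta>) (length \<eta>)
       (\<lambda>(i, j). (1 / real (length X)) * (\<Sum>l<length X. (\<eta> ! i) (X ! l) * (\<eta> ! j) (X ! l)))"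

definition vec_tensor :: "('a \<Rightarrow> real) list \<Rightarrow> ('a \<Rightarrow> real) list \<Rightarrow> ('a \<Rightarrow> real) list" where
  "vec_tensor \<theta> \<phi> =
     map (\<lambda>ix x. (\<theta> ! (ix ! 0)) x * (\<phi> ! (ix ! 1)) x) (multi_indices [length \<theta>, length \<phi>])"

text \<open>
  \<open>\<theta> 0, \<dots>, \<theta> p\<close> arise from one run of the recursion, with some admissible choice of the
  matrices \<open>U 1, \<dots>, U p\<close>, and all gap conditions hold along the way. The \<open>k\<close>-th empirical
  spectral subspace is then \<open>fn_span (set (\<theta> k))\<close>.
\<close>

definition empirical_spectral_bases ::
  "(nat \<Rightarrow> ('a \<Rightarrow> real) list) \<Rightarrow> nat \<Rightarrow> (nat \<Rightarrow> nat) \<Rightarrow> 'a list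
    \<Rightarrow> (nat \<Rightarrow> ('a \<Rightarrow> real) list) \<Rightarrow> bool" where
  "empirical_spectral_bases \<psi> p r X \<theta> \<longleftrightarrow>
     \<theta> 0 = [\<lambda>_. 1] \<and>
     (\<forall>k\<in>{1..p}.
        let \<eta> = vec_tensor (\<theta> (k - 1)) (\<psi> k); C = empirical_cov \<eta> X in
        spectral_gap C (r k) \<and>
        (\<exists>U \<in> carrier_mat (length \<eta>) (r k).
           orthonormal_basis (length \<eta>) (cols U) (leading_eigenspace C (r k)) \<and>
           \<theta> k = fn_mult \<eta> U))"

end

theory Submission
  imports Defs "Jordan_Normal_Form.DL_Rank"
begin

text \<open>
  Both constructions are the same recursion, run in two different orthonormal coordinate systems.
  Write \<open>\<theta>\<^sub>k\<close> for the functions with coefficient matrix \<open>B\<^sub>k\<close>, the unfolded partial tensor train of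
  the final cores. Splitting off the last core gives \<open>B\<^sub>k = (B\<^bsub>k-1\<^esub> \<otimes> Id) U\<^sub>k\<close>, where \<open>U\<^sub>k\<close> holds the
  left singular vectors kept at step \<open>k\<close>; in terms of functions, \<open>\<theta>\<^sub>k\<^sup>T = vec(\<theta>\<^bsub>k-1\<^esub> \<otimes> \<psi>\<^sub>k)\<^sup>T U\<^sub>k\<close>
  (\<open>tt_coeffs_Suc\<close>, \<open>vec_tensor_fn_mult\<close>). Since the columns of \<open>U\<^sub>k\<close> are orthonormal, so are those
  of \<open>B\<^sub>k\<close>.

  The matrix \<open>A\<^sub>k\<close> that is decomposed at step \<open>k\<close> consists of the values of \<open>vec(\<theta>\<^bsub>k-1\<^esub> \<otimes> \<psi>\<^sub>k)\<close> at
  the data points. Indeed \<open>\<Sigma>V\<^sup>T = U\<^sup>T A\<close> for a truncated SVD, so the factor passed on by the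
  previous step is \<open>\<theta>\<^bsub>k-1\<^esub>(X)\<close>, and the data core, being diagonal in its two rank indices, multiplies
  this row by row with the values of \<open>\<psi>\<^sub>k\<close> (\<open>global_svd_evaluations\<close>). For \<open>k = p\<close> the same
  identity \<open>\<Sigma>V\<^sup>T = \<theta>\<^sub>p(X)\<close> is the second claim.

  Consequently \<open>A\<^sub>k A\<^sub>k\<^sup>T\<close> is \<open>m\<close> times the empirical covariance of \<open>vec(\<theta>\<^bsub>k-1\<^esub> \<otimes> \<psi>\<^sub>k)\<close>, and the
  SVD of \<open>A\<^sub>k\<close> diagonalizes it. Suppose that \<open>\<theta>\<^bsub>k-1\<^esub>\<close> arises from the basis \<open>\<theta>'\<^bsub>k-1\<^esub>\<close> of the
  spectral recursion by an orthogonal matrix \<open>Q\<close>. Then the two covariance matrices are conjugate by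
  \<open>K = Q \<otimes> Id\<close>, so the columns of \<open>K U\<^sub>k\<close> lie in the leading eigenspace from which the spectral
  recursion takes its orthonormal basis \<open>U'\<^sub>k\<close>. Two orthonormal families of the same size \<open>r\<^sub>k\<close>, one
  in the span of the other, differ by an orthogonal matrix, so \<open>\<theta>\<^sub>k\<close> again arises from \<open>\<theta>'\<^sub>k\<close> by an
  orthogonal matrix (\<open>leading_singular_vectors_change_of_basis\<close>). Therefore both span
  the same space, whose coefficient space is the column space of \<open>B\<^sub>k\<close> because the product basis is
  linearly independent.
\<close>

section \<open>Lexicographic enumeration of multi-indices\<close>

lemma product_lists_snoc:
  "product_lists (xss @ [ys]) = concat (map (\<lambda>xs. map (\<lambda>y. xs @ [y]) ys) (product_lists xss))"
proof (induction xss)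
  case (Cons xs xss)
  have distrib: "concat (map f (concat zss)) = concat (map (\<lambda>zs. concat (map f zs)) zss)"
    for f :: "'a list \<Rightarrow> 'a list list" and zss
    by (induction zss) auto
  have "product_lists ((xs # xss) @ [ys]) =
      concat (map (\<lambda>x. map (Cons x) (product_lists (xss @ [ys]))) xs)" by simp
  also have "\<dots> = concat (map (\<lambda>x. concat (map (\<lambda>zs. map (\<lambda>y. zs @ [y]) ys)
      (map (Cons x) (product_lists xss)))) xs)"
    unfolding Cons by (simp add: map_concat o_def)
  also have "\<dots> = concat (map (\<lambda>zs. map (\<lambda>y. zs @ [y]) ys) (product_lists (xs # xss)))"
    by (simp only: distrib product_lists.simps map_map o_def)
  finally show ?case .
qed simp

lemma concat_map_map_upt:
  "concat (map (\<lambda>x. map (f x) [0..<n]) xs) =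
     map (\<lambda>i. f (xs ! (i div n)) (i mod n)) [0..<length xs * n]"
proof (induction xs rule: rev_induct)
  case (snoc x xs)
  have split: "[0..<length (xs @ [x]) * n] = [0..<length xs * n] @ map (\<lambda>i. length xs * n + i) [0..<n]"
    using upt_add_eq_append[of 0 "length xs * n" n] map_add_upt[of "length xs * n" n]
    by (simp add: add.commute)
  have old: "(xs @ [x]) ! (i div n) = xs ! (i div n)" if "i < length xs * n" for i
    using that by (simp add: nth_append less_mult_imp_div_less)
  show ?case
    unfolding split map_append map_map using snoc old by (simp add: o_def)
qed simp

lemma multi_indices_Nil [simp]: "multi_indices [] = [[]]"
  by (simp add: multi_indices_def)

text \<open>
  The last mode varies fastest, so positions are recovered by division with remainder. This fixes the
  ordering once and for all: everything below works with positions instead of multi-indices.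
\<close>

lemma multi_indices_snoc:
  "multi_indices (ns @ [n]) =
     map (\<lambda>i. multi_indices ns ! (i div n) @ [i mod n]) [0..<length (multi_indices ns) * n]"
  by (simp add: multi_indices_def product_lists_snoc concat_map_map_upt)

lemma length_multi_indices_snoc [simp]:
  "length (multi_indices (ns @ [n])) = length (multi_indices ns) * n"
  by (simp add: multi_indices_snoc)

lemma nth_multi_indices_snoc:
  "i < length (multi_indices ns) * n \<Longrightarrow>
     multi_indices (ns @ [n]) ! i = multi_indices ns ! (i div n) @ [i mod n]"
  by (simp add: multi_indices_snoc)

lemma multi_indices_single: "multi_indices [n] = map (\<lambda>i. [i]) [0..<n]"
  using multi_indices_snoc[of "[]" n] by simp

lemma multi_indices_pair: "multi_indices [a, b] = map (\<lambda>i. [i div b, i mod b]) [0..<a * b]"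
  using multi_indices_snoc[of "[a]" b] by (simp add: multi_indices_single less_mult_imp_div_less)

lemma length_in_multi_indices: "ix \<in> set (multi_indices ns) \<Longrightarrow> length ix = length ns"
  by (auto simp: multi_indices_def dest: in_set_product_lists_length)

lemma length_nth_multi_indices:
  "i < length (multi_indices ns) \<Longrightarrow> length (multi_indices ns ! i) = length ns"
  by (rule length_in_multi_indices) simp

lemma div_mod_bounds: "i < a * (n::nat) \<Longrightarrow> i div n < a \<and> i mod n < n"
  by (cases "n = 0") (auto simp: less_mult_imp_div_less)

lemma pair_index_bound: "a < b \<Longrightarrow> i < n \<Longrightarrow> a * n + i < b * (n::nat)"
proof -
  assume "a < b" "i < n"
  then have "Suc a * n \<le> b * n" by (intro mult_right_mono) auto
  then show ?thesis using \<open>i < n\<close> by simp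
qed

lemma sum_pair_index:
  fixes f :: "nat \<Rightarrow> nat \<Rightarrow> 'a :: comm_monoid_add"
  shows "(\<Sum>i<a * n. f (i div n) (i mod n)) = (\<Sum>j<a. \<Sum>k<n. f j k)"
proof -
  let ?g = "\<lambda>i. f (i div n) (i mod n)"
  have block: "sum ?g {j * n..<j * n + n} = (\<Sum>k<n. f j k)" for j
  proof -
    have "sum ?g {j * n..<j * n + n} = (\<Sum>k=0..<n. ?g (k + j * n))"
      using sum.shift_bounds_nat_ivl[of ?g 0 "j * n" n] by (simp only: add_0_left add.commute[of n])
    also have "\<dots> = (\<Sum>k<n. f j k)" by (rule sum.cong) auto
    finally show ?thesis .
  qed
  show ?thesis
    unfolding sum.nat_group[of ?g n a, symmetric] block ..
qed

section \<open>Kronecker products with an identity matrix\<close>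

text \<open>
  \<open>M \<otimes> Id\<^sub>n\<close>, in the ordering where the pair \<open>(i, k)\<close> has position \<open>i n + k\<close>, so that it agrees with the
  rows of unfolded tensors.
\<close>

definition kron_id :: "real mat \<Rightarrow> nat \<Rightarrow> real mat" where
  "kron_id M n = mat (dim_row M * n) (dim_col M * n)
     (\<lambda>(i, j). if i mod n = j mod n then M $$ (i div n, j div n) else 0)"

lemma kron_id_carrier: "M \<in> carrier_mat a b \<Longrightarrow> kron_id M n \<in> carrier_mat (a * n) (b * n)"
  by (auto simp: kron_id_def)

lemma index_kron_id:
  "M \<in> carrier_mat a b \<Longrightarrow> i < a * n \<Longrightarrow> j < b * n \<Longrightarrow>
    kron_id M n $$ (i, j) = (if i mod n = j mod n then M $$ (i div n, j div n) else 0)"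
  by (auto simp: kron_id_def)

lemma index_mat_mult_sum:
  assumes "A \<in> carrier_mat a b" "B \<in> carrier_mat b c" "i < a" "j < c"
  shows "(A * B) $$ (i, j) = (\<Sum>k<b. A $$ (i, k) * B $$ (k, j))"
  using assms by (auto simp: scalar_prod_def lessThan_atLeast0)

text \<open>
  The mixed-product rule. Together with the next two lemmas it shows that tensoring with an identity
  preserves orthonormality of columns.
\<close>

lemma kron_id_mult:
  assumes A: "A \<in> carrier_mat a b" and B: "B \<in> carrier_mat b c"
  shows "kron_id A n * kron_id B n = kron_id (A * B) n"
proof (rule eq_matI)
  have AB: "A * B \<in> carrier_mat a c" using A B by simp
  fix i j assume "i < dim_row (kron_id (A * B) n)" "j < dim_col (kron_id (A * B) n)"
  then have i: "i < a * n" and j: "j < c * n" using kron_id_carrier[OF AB, of n] by auto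
  note ij = div_mod_bounds[OF i] div_mod_bounds[OF j]
  have "(kron_id A n * kron_id B n) $$ (i, j) =
      (\<Sum>k<b * n. (if i mod n = k mod n then A $$ (i div n, k div n) else 0) *
        (if k mod n = j mod n then B $$ (k div n, j div n) else 0))"
    unfolding index_mat_mult_sum[OF kron_id_carrier[OF A] kron_id_carrier[OF B] i j]
    using i j by (intro sum.cong) (auto simp: index_kron_id[OF A] index_kron_id[OF B])
  also have "\<dots> = (\<Sum>k<b. \<Sum>l<n. (if i mod n = l then A $$ (i div n, k) else 0) *
        (if l = j mod n then B $$ (k, j div n) else 0))"
    by (rule sum_pair_index[where f = "\<lambda>k l. (if i mod n = l then A $$ (i div n, k) else 0) *
        (if l = j mod n then B $$ (k, j div n) else 0)"])
  also have "\<dots> = (\<Sum>k<b. if i mod n = j mod n then A $$ (i div n, k) * B $$ (k, j div n) else 0)"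
  proof (rule sum.cong[OF refl])
    fix k
    have "(\<Sum>l<n. (if i mod n = l then A $$ (i div n, k) else 0) *
        (if l = j mod n then B $$ (k, j div n) else 0)) =
      (\<Sum>l<n. if i mod n = l then A $$ (i div n, k) *
        (if i mod n = j mod n then B $$ (k, j div n) else 0) else 0)"
      by (intro sum.cong) auto
    then show "(\<Sum>l<n. (if i mod n = l then A $$ (i div n, k) else 0) *
        (if l = j mod n then B $$ (k, j div n) else 0)) =
      (if i mod n = j mod n then A $$ (i div n, k) * B $$ (k, j div n) else 0)"
      using ij by simp
  qed
  also have "\<dots> = kron_id (A * B) n $$ (i, j)"
    unfolding index_kron_id[OF AB i j] using ij by (simp add: index_mat_mult_sum[OF A B])
  finally show "(kron_id A n * kron_id B n) $$ (i, j) = kron_id (A * B) n $$ (i, j)" .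
qed (use A B in \<open>auto simp: kron_id_def\<close>)

lemma kron_id_one: "kron_id (1\<^sub>m a) n = 1\<^sub>m (a * n)"
proof (rule eq_matI)
  fix i j assume "i < dim_row (1\<^sub>m (a * n))" "j < dim_col (1\<^sub>m (a * n))"
  then have i: "i < a * n" and j: "j < a * n" by auto
  have "i mod n = j mod n \<and> i div n = j div n \<longleftrightarrow> i = j"
    by (metis div_mult_mod_eq)
  then show "kron_id (1\<^sub>m a) n $$ (i, j) = 1\<^sub>m (a * n) $$ (i, j)"
    using i j div_mod_bounds[OF i] div_mod_bounds[OF j] by (auto simp: kron_id_def)
qed (auto simp: kron_id_def)

lemma transpose_kron_id: "(kron_id M n)\<^sup>T = kron_id M\<^sup>T n"
proof (rule eq_matI)
  fix i j assume "i < dim_row (kron_id M\<^sup>T n)" "j < dim_col (kron_id M\<^sup>T n)"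
  then have "i < dim_col M * n" "j < dim_row M * n" by (auto simp: kron_id_def)
  then show "(kron_id M n)\<^sup>T $$ (i, j) = kron_id M\<^sup>T n $$ (i, j)"
    by (auto simp: kron_id_def dest!: div_mod_bounds)
qed (auto simp: kron_id_def)

section \<open>Tuples of functions and their coefficient matrices\<close>

lemma length_fn_mult [simp]: "length (fn_mult \<eta> U) = dim_col U"
  by (simp add: fn_mult_def)

lemma nth_fn_mult:
  "j < dim_col U \<Longrightarrow> (fn_mult \<eta> U ! j) x = (\<Sum>i<length \<eta>. (\<eta> ! i) x * U $$ (i, j))"
  by (simp add: fn_mult_def)

lemma fn_mult_fn_mult:
  assumes A: "A \<in> carrier_mat (length \<eta>) b" and B: "B \<in> carrier_mat b c"
  shows "fn_mult (fn_mult \<eta> A) B = fn_mult \<eta> (A * B)"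
proof (rule nth_equalityI)
  fix j assume "j < length (fn_mult (fn_mult \<eta> A) B)"
  then have j: "j < c" using B by simp
  show "fn_mult (fn_mult \<eta> A) B ! j = fn_mult \<eta> (A * B) ! j"
  proof
    fix x
    have "(fn_mult (fn_mult \<eta> A) B ! j) x =
        (\<Sum>k<b. (\<Sum>i<length \<eta>. (\<eta> ! i) x * A $$ (i, k)) * B $$ (k, j))"
      using A B j by (auto simp: nth_fn_mult intro!: sum.cong)
    also have "\<dots> = (\<Sum>k<b. \<Sum>i<length \<eta>. (\<eta> ! i) x * (A $$ (i, k) * B $$ (k, j)))"
      by (simp add: sum_distrib_right mult.assoc)
    also have "\<dots> = (\<Sum>i<length \<eta>. \<Sum>k<b. (\<eta> ! i) x * (A $$ (i, k) * B $$ (k, j)))"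
      by (rule sum.swap)
    also have "\<dots> = (\<Sum>i<length \<eta>. (\<eta> ! i) x * (A * B) $$ (i, j))"
      using j by (simp add: index_mat_mult_sum[OF A B] sum_distrib_left)
    also have "\<dots> = (fn_mult \<eta> (A * B) ! j) x" using B j by (simp add: nth_fn_mult)
    finally show "(fn_mult (fn_mult \<eta> A) B ! j) x = (fn_mult \<eta> (A * B) ! j) x" .
  qed
qed (use B in simp)

lemma fn_mult_one: "fn_mult \<eta> (1\<^sub>m (length \<eta>)) = \<eta>"
proof (rule nth_equalityI)
  fix j assume "j < length (fn_mult \<eta> (1\<^sub>m (length \<eta>)))"
  then have j: "j < length \<eta>" by simp
  have "(fn_mult \<eta> (1\<^sub>m (length \<eta>)) ! j) x = (\<eta> ! j) x" for x
  proof -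
    have "(fn_mult \<eta> (1\<^sub>m (length \<eta>)) ! j) x =
        (\<Sum>i<length \<eta>. (\<eta> ! i) x * (if i = j then 1 else 0))"
      using j by (simp add: nth_fn_mult)
    also have "\<dots> = (\<Sum>i<length \<eta>. if i = j then (\<eta> ! i) x else 0)"
      by (intro sum.cong) auto
    finally show ?thesis using j by simp
  qed
  then show "fn_mult \<eta> (1\<^sub>m (length \<eta>)) ! j = \<eta> ! j" by auto
qed simp

lemma length_vec_tensor [simp]: "length (vec_tensor \<theta> \<phi>) = length \<theta> * length \<phi>"
  by (simp add: vec_tensor_def multi_indices_pair)

lemma nth_vec_tensor:
  "i < length \<theta> * length \<phi> \<Longrightarrow>
    (vec_tensor \<theta> \<phi> ! i) x = (\<theta> ! (i div length \<phi>)) x * (\<phi> ! (i mod length \<phi>)) x"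
  by (simp add: vec_tensor_def multi_indices_pair)

text \<open>
  A change of coordinates in the left factor of a tensor product is \<open>A \<otimes> Id\<close> on the product. This is what
  carries the coefficients of one recursion step, and the comparison of two bases, to the next step.
\<close>

lemma vec_tensor_fn_mult:
  assumes A: "A \<in> carrier_mat (length \<theta>) b"
  shows "vec_tensor (fn_mult \<theta> A) \<phi> = fn_mult (vec_tensor \<theta> \<phi>) (kron_id A (length \<phi>))"
proof (rule nth_equalityI)
  let ?n = "length \<phi>"
  note K = kron_id_carrier[OF A, of ?n]
  fix j assume "j < length (vec_tensor (fn_mult \<theta> A) \<phi>)"
  then have j: "j < b * ?n" using A by simp
  note jb = div_mod_bounds[OF j]
  show "vec_tensor (fn_mult \<theta> A) \<phi> ! j = fn_mult (vec_tensor \<theta> \<phi>) (kron_id A ?n) ! j"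
  proof
    fix x
    have "(fn_mult (vec_tensor \<theta> \<phi>) (kron_id A ?n) ! j) x =
        (\<Sum>i<length \<theta> * ?n. (\<theta> ! (i div ?n)) x * (\<phi> ! (i mod ?n)) x *
          (if i mod ?n = j mod ?n then A $$ (i div ?n, j div ?n) else 0))"
      using K j by (auto simp: nth_fn_mult nth_vec_tensor index_kron_id[OF A] intro!: sum.cong)
    also have "\<dots> = (\<Sum>k<length \<theta>. \<Sum>l<?n. (\<theta> ! k) x * (\<phi> ! l) x *
          (if l = j mod ?n then A $$ (k, j div ?n) else 0))"
      by (rule sum_pair_index[where f = "\<lambda>k l. (\<theta> ! k) x * (\<phi> ! l) x *
          (if l = j mod ?n then A $$ (k, j div ?n) else 0)"])
    also have "\<dots> = (\<Sum>k<length \<theta>. (\<theta> ! k) x * (\<phi> ! (j mod ?n)) x * A $$ (k, j div ?n))"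
    proof (rule sum.cong[OF refl])
      fix k
      have "(\<Sum>l<?n. (\<theta> ! k) x * (\<phi> ! l) x * (if l = j mod ?n then A $$ (k, j div ?n) else 0)) =
          (\<Sum>l<?n. if l = j mod ?n then (\<theta> ! k) x * (\<phi> ! l) x * A $$ (k, j div ?n) else 0)"
        by (intro sum.cong) auto
      then show "(\<Sum>l<?n. (\<theta> ! k) x * (\<phi> ! l) x * (if l = j mod ?n then A $$ (k, j div ?n) else 0)) =
          (\<theta> ! k) x * (\<phi> ! (j mod ?n)) x * A $$ (k, j div ?n)"
        using jb by simp
    qed
    also have "\<dots> = (vec_tensor (fn_mult \<theta> A) \<phi> ! j) x"
      using A j jb by (simp add: nth_vec_tensor nth_fn_mult sum_distrib_left sum_distrib_right ac_simps)
    finally show "(vec_tensor (fn_mult \<theta> A) \<phi> ! j) x =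
        (fn_mult (vec_tensor \<theta> \<phi>) (kron_id A ?n) ! j) x" ..
  qed
qed (use A in \<open>simp add: kron_id_def\<close>)

lemma eval_mat_carrier [simp]: "eval_mat \<theta> X \<in> carrier_mat (length \<theta>) (length X)"
  by (simp add: eval_mat_def)

lemma index_eval_mat:
  "i < length \<theta> \<Longrightarrow> l < length X \<Longrightarrow> eval_mat \<theta> X $$ (i, l) = (\<theta> ! i) (X ! l)"
  by (simp add: eval_mat_def)

lemma eval_mat_fn_mult:
  assumes A: "A \<in> carrier_mat (length \<eta>) b"
  shows "eval_mat (fn_mult \<eta> A) X = A\<^sup>T * eval_mat \<eta> X"
proof (rule eq_matI)
  have At: "A\<^sup>T \<in> carrier_mat b (length \<eta>)" using A by simp
  fix i j assume "i < dim_row (A\<^sup>T * eval_mat \<eta> X)" "j < dim_col (A\<^sup>T * eval_mat \<eta> X)"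
  then have i: "i < b" and j: "j < length X" using A by (auto simp: eval_mat_def)
  show "eval_mat (fn_mult \<eta> A) X $$ (i, j) = (A\<^sup>T * eval_mat \<eta> X) $$ (i, j)"
    unfolding index_mat_mult_sum[OF At eval_mat_carrier i j]
    using A i j by (auto simp: index_eval_mat nth_fn_mult intro!: sum.cong)
qed (use A in \<open>auto simp: eval_mat_def\<close>)

lemma empirical_cov_eq_eval_mat:
  "empirical_cov \<eta> X = (1 / real (length X)) \<cdot>\<^sub>m (eval_mat \<eta> X * (eval_mat \<eta> X)\<^sup>T)"
proof (rule eq_matI)
  fix i j
  assume "i < dim_row ((1 / real (length X)) \<cdot>\<^sub>m (eval_mat \<eta> X * (eval_mat \<eta> X)\<^sup>T))"
    "j < dim_col ((1 / real (length X)) \<cdot>\<^sub>m (eval_mat \<eta> X * (eval_mat \<eta> X)\<^sup>T))"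
  then have i: "i < length \<eta>" and j: "j < length \<eta>" by (auto simp: eval_mat_def)
  have Et: "(eval_mat \<eta> X)\<^sup>T \<in> carrier_mat (length X) (length \<eta>)" by simp
  have "(eval_mat \<eta> X * (eval_mat \<eta> X)\<^sup>T) $$ (i, j) =
      (\<Sum>l<length X. (\<eta> ! i) (X ! l) * (\<eta> ! j) (X ! l))"
    unfolding index_mat_mult_sum[OF eval_mat_carrier Et i j]
    using i j by (auto simp: eval_mat_def intro!: sum.cong)
  then show "empirical_cov \<eta> X $$ (i, j) =
      ((1 / real (length X)) \<cdot>\<^sub>m (eval_mat \<eta> X * (eval_mat \<eta> X)\<^sup>T)) $$ (i, j)"
    using i j by (simp add: empirical_cov_def eval_mat_def)
qed (auto simp: empirical_cov_def eval_mat_def)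

lemma empirical_cov_carrier: "empirical_cov \<eta> X \<in> carrier_mat (length \<eta>) (length \<eta>)"
  by (simp add: empirical_cov_def)

text \<open>
  Covariance matrices transform by congruence; for an orthogonal matrix this is a similarity, which
  preserves the spectrum.
\<close>

lemma empirical_cov_fn_mult:
  assumes A: "A \<in> carrier_mat (length \<eta>) b"
  shows "empirical_cov (fn_mult \<eta> A) X = A\<^sup>T * empirical_cov \<eta> X * A"
proof -
  define E where "E = eval_mat \<eta> X"
  let ?n = "length \<eta>" and ?m = "length X"
  have E: "E \<in> carrier_mat ?n ?m" by (simp add: E_def)
  have Et: "E\<^sup>T \<in> carrier_mat ?m ?n" and At: "A\<^sup>T \<in> carrier_mat b ?n" using A E by auto
  have EE: "E * E\<^sup>T \<in> carrier_mat ?n ?n" using E Et by (rule mult_carrier_mat)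
  have AEE: "A\<^sup>T * (E * E\<^sup>T) \<in> carrier_mat b ?n" using At EE by (rule mult_carrier_mat)
  have "A\<^sup>T * E * (A\<^sup>T * E)\<^sup>T = A\<^sup>T * E * (E\<^sup>T * A)"
    by (simp add: transpose_mult[OF At E])
  also have "\<dots> = A\<^sup>T * (E * (E\<^sup>T * A))"
    by (rule assoc_mult_mat[OF At E]) (rule mult_carrier_mat[OF Et A])
  also have "\<dots> = A\<^sup>T * (E * E\<^sup>T * A)"
    by (simp only: assoc_mult_mat[OF E Et A])
  also have "\<dots> = A\<^sup>T * (E * E\<^sup>T) * A"
    by (simp only: assoc_mult_mat[OF At EE A])
  finally have eq: "A\<^sup>T * E * (A\<^sup>T * E)\<^sup>T = A\<^sup>T * (E * E\<^sup>T) * A" .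
  show ?thesis
    unfolding empirical_cov_eq_eval_mat eval_mat_fn_mult[OF A] E_def[symmetric] eq
      mult_smult_distrib[OF At EE] mult_smult_assoc_mat[OF AEE A] ..
qed

lemma sum_fun_apply: "(\<Sum>v\<in>S. f v) x = (\<Sum>v\<in>S. f v x)"
  for f :: "'b \<Rightarrow> 'a \<Rightarrow> real"
  by (induction S rule: infinite_finite_induct) auto

text \<open>
  Coefficients are indexed by positions rather than by functions, so that coefficient vectors and
  matrices act on the tuple directly.
\<close>

lemma fn_span_set:
  "fn_span (set fs) = {f. \<exists>c. \<forall>x. f x = (\<Sum>i<length fs. c i * (fs ! i) x)}" (is "_ = ?R")
proof
  have "set fs \<subseteq> ?R"
  proof
    fix f assume "f \<in> set fs"
    then obtain j where j: "j < length fs" "f = fs ! j" by (auto simp: in_set_conv_nth)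
    have "f x = (\<Sum>i<length fs. (if i = j then 1 else 0) * (fs ! i) x)" for x
    proof -
      have "(\<Sum>i<length fs. (if i = j then 1 else 0) * (fs ! i) x) =
          (\<Sum>i<length fs. if i = j then (fs ! i) x else 0)"
        by (intro sum.cong) auto
      then show ?thesis using j by simp
    qed
    then show "f \<in> ?R" by (intro CollectI exI[of _ "\<lambda>i. if i = j then 1 else 0"]) blast
  qed
  moreover have "fn.subspace ?R"
  proof (rule fn.subspaceI)
    show "0 \<in> ?R" by (auto intro!: exI[of _ "\<lambda>_. 0"])
  next
    fix f g assume "f \<in> ?R" "g \<in> ?R"
    then obtain c d where cd: "\<And>x. f x = (\<Sum>i<length fs. c i * (fs ! i) x)"
      "\<And>x. g x = (\<Sum>i<length fs. d i * (fs ! i) x)" by auto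
    show "f + g \<in> ?R"
      by (intro CollectI exI[of _ "\<lambda>i. c i + d i"])
        (simp add: cd sum.distrib distrib_right)
  next
    fix a f assume "f \<in> ?R"
    then obtain c where c: "\<And>x. f x = (\<Sum>i<length fs. c i * (fs ! i) x)" by auto
    show "(\<lambda>x. a * f x) \<in> ?R"
      by (intro CollectI exI[of _ "\<lambda>i. a * c i"]) (simp add: c sum_distrib_left mult.assoc)
  qed
  ultimately show "fn_span (set fs) \<subseteq> ?R" by (rule fn.span_minimal)
next
  show "?R \<subseteq> fn_span (set fs)"
  proof
    fix f assume "f \<in> ?R"
    then obtain c where c: "\<And>x. f x = (\<Sum>i<length fs. c i * (fs ! i) x)" by auto
    have f: "f = (\<Sum>i<length fs. (\<lambda>x. c i * (fs ! i) x))"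
      by (rule ext) (simp add: c sum_fun_apply)
    show "f \<in> fn_span (set fs)"
      unfolding f by (intro fn.span_sum fn.span_scale fn.span_base) auto
  qed
qed

text \<open>
  Positions also absorb the distinctness requirement: a repeated function gives the nontrivial relation
  \<open>f - f = 0\<close>.
\<close>

lemma fn_indep_iff:
  "fn_indep fs \<longleftrightarrow>
    (\<forall>c. (\<forall>x. (\<Sum>i<length fs. c i * (fs ! i) x) = 0) \<longrightarrow> (\<forall>i<length fs. c i = 0))"
  (is "_ \<longleftrightarrow> ?R")
proof -
  have reindex: "(\<Sum>v\<in>set fs. g v) = (\<Sum>i<length fs. g (fs ! i))" if "distinct fs"
    for g :: "('a \<Rightarrow> real) \<Rightarrow> real"
    using that by (simp add: sum.distinct_set_conv_list sum_list_sum_nth lessThan_atLeast0)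
  have dep: "fn_dependent (set fs) \<longleftrightarrow>
      (\<exists>u. (\<exists>v\<in>set fs. u v \<noteq> 0) \<and> (\<forall>x. (\<Sum>v\<in>set fs. u v * v x) = 0))"
    unfolding fn.dependent_finite[OF finite_set] by (simp add: fun_eq_iff sum_fun_apply)
  show ?thesis
  proof
    assume ind: "fn_indep fs"
    then have d: "distinct fs" and nd: "\<not> fn_dependent (set fs)" by (auto simp: fn_indep_def)
    show ?R
    proof (intro allI impI)
      fix c i assume c: "\<forall>x. (\<Sum>i<length fs. c i * (fs ! i) x) = 0" and i: "i < length fs"
      \<comment> \<open>the entries of \<open>fs\<close> are distinct, so coefficients of positions are coefficients of functions\<close>
      define u where "u v = c (THE i. i < length fs \<and> fs ! i = v)" for v
      have u: "u (fs ! j) = c j" if "j < length fs" for j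
      proof -
        have "(THE i. i < length fs \<and> fs ! i = fs ! j) = j"
          using that d by (auto simp: nth_eq_iff_index_eq)
        then show ?thesis by (simp add: u_def)
      qed
      have "\<forall>x. (\<Sum>v\<in>set fs. u v * v x) = 0"
        using c u by (simp add: reindex[OF d])
      then have "\<forall>v\<in>set fs. u v = 0" using nd dep by blast
      then have "u (fs ! i) = 0" using i by simp
      then show "c i = 0" using u i by simp
    qed
  next
    assume R: ?R
    have d: "distinct fs"
      unfolding distinct_conv_nth
    proof (intro allI impI notI)
      fix i j assume ij: "i < length fs" "j < length fs" "i \<noteq> j" "fs ! i = fs ! j"
      let ?c = "\<lambda>k. (if k = i then 1 else 0) - (if k = j then 1 else (0::real))"
      have "(\<Sum>k<length fs. ?c k * (fs ! k) x) = 0" for x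
      proof -
        have "(\<Sum>k<length fs. ?c k * (fs ! k) x) =
            (\<Sum>k<length fs. (if k = i then (fs ! k) x else 0) - (if k = j then (fs ! k) x else 0))"
          by (intro sum.cong) auto
        then show ?thesis using ij by (simp add: sum_subtractf)
      qed
      then have "?c i = 0" using R[rule_format, of ?c i] ij(1) by blast
      then show False using ij by simp
    qed
    moreover have "\<not> fn_dependent (set fs)"
    proof
      assume "fn_dependent (set fs)"
      then obtain u v where v: "v \<in> set fs" "u v \<noteq> 0"
        and u: "\<forall>x. (\<Sum>v\<in>set fs. u v * v x) = 0" by (auto simp: dep)
      obtain i where i: "i < length fs" "v = fs ! i" using v by (auto simp: in_set_conv_nth)
      have "\<forall>x. (\<Sum>i<length fs. u (fs ! i) * (fs ! i) x) = 0"
        using u by (simp add: reindex[OF d])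
      then have "\<forall>i<length fs. u (fs ! i) = 0" using R[rule_format, of "\<lambda>i. u (fs ! i)"] by blast
      then show False using i v by auto
    qed
    ultimately show "fn_indep fs" by (simp add: fn_indep_def)
  qed
qed

lemma fn_indepD:
  assumes "fn_indep fs" "\<And>x. (\<Sum>i<length fs. c i * (fs ! i) x) = (\<Sum>i<length fs. d i * (fs ! i) x)"
    "i < length fs"
  shows "c i = d i"
proof -
  have "\<forall>x. (\<Sum>i<length fs. (c i - d i) * (fs ! i) x) = 0"
    using assms(2) by (simp add: left_diff_distrib sum_subtractf)
  then have "c i - d i = 0" using assms(1,3) unfolding fn_indep_iff by meson
  then show ?thesis by simp
qed

lemma linear_combination_fn_mult:
  assumes B: "B \<in> carrier_mat (length fs) r"
  shows "(\<Sum>j<r. c j * (fn_mult fs B ! j) x) =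
    (\<Sum>i<length fs. vec_index (B *\<^sub>v Matrix.vec r c) i * (fs ! i) x)"
proof -
  have "(\<Sum>j<r. c j * (fn_mult fs B ! j) x) =
      (\<Sum>j<r. \<Sum>i<length fs. B $$ (i, j) * c j * (fs ! i) x)"
    using B by (intro sum.cong) (auto simp: nth_fn_mult sum_distrib_left ac_simps)
  also have "\<dots> = (\<Sum>i<length fs. \<Sum>j<r. B $$ (i, j) * c j * (fs ! i) x)"
    by (rule sum.swap)
  also have "\<dots> = (\<Sum>i<length fs. vec_index (B *\<^sub>v Matrix.vec r c) i * (fs ! i) x)"
    using B by (intro sum.cong) (auto simp: scalar_prod_def sum_distrib_right lessThan_atLeast0)
  finally show ?thesis .
qed

text \<open>
  Orthonormal columns make \<open>B\<close> injective: \<open>B w = 0\<close> implies \<open>w = B\<^sup>T B w = 0\<close>.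
\<close>

lemma fn_indep_fn_mult:
  assumes fs: "fn_indep fs" and B: "B \<in> carrier_mat (length fs) r" and BB: "B\<^sup>T * B = 1\<^sub>m r"
  shows "fn_indep (fn_mult fs B)"
  unfolding fn_indep_iff
proof (intro allI impI)
  fix c j
  assume c: "\<forall>x. (\<Sum>j<length (fn_mult fs B). c j * (fn_mult fs B ! j) x) = 0"
    and "j < length (fn_mult fs B)"
  then have j: "j < r" using B by simp
  define w where "w = Matrix.vec r c"
  have w: "w \<in> carrier_vec r" by (simp add: w_def)
  have "(\<Sum>i<length fs. vec_index (B *\<^sub>v w) i * (fs ! i) x) = (\<Sum>i<length fs. 0 * (fs ! i) x)" for x
    using c B unfolding w_def linear_combination_fn_mult[OF B, symmetric] by simp
  then have "vec_index (B *\<^sub>v w) i = 0" if "i < length fs" for i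
    using fn_indepD[OF fs, of "vec_index (B *\<^sub>v w)" "\<lambda>_. 0"] that by blast
  then have Bw: "B *\<^sub>v w = 0\<^sub>v (length fs)" using B by (intro eq_vecI) auto
  have Bt: "B\<^sup>T \<in> carrier_mat r (length fs)" using B by simp
  have "w = B\<^sup>T * B *\<^sub>v w" using w by (simp add: BB)
  also have "\<dots> = B\<^sup>T *\<^sub>v 0\<^sub>v (length fs)" unfolding assoc_mult_mat_vec[OF Bt B w] Bw ..
  also have "\<dots> = 0\<^sub>v r" using B by (intro eq_vecI) auto
  finally have "vec_index w j = 0" using j by simp
  then show "c j = 0" using j by (simp add: w_def)
qed

text \<open>
  Independence makes coefficient vectors unique, so a function in the span can only have the coefficients
  \<open>B w\<close> that its expansion in the new tuple provides.
\<close>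

lemma coeff_space_fn_mult:
  assumes fs: "fn_indep fs" and B: "B \<in> carrier_mat (length fs) r"
  shows "coeff_space fs (fn_span (set (fn_mult fs B))) = (\<lambda>w. B *\<^sub>v w) ` carrier_vec r"
proof (intro equalityI subsetI)
  fix v assume "v \<in> coeff_space fs (fn_span (set (fn_mult fs B)))"
  then have v: "v \<in> carrier_vec (length fs)"
    and "\<exists>c. \<forall>x. (\<Sum>i<length fs. vec_index v i * (fs ! i) x) = (\<Sum>j<r. c j * (fn_mult fs B ! j) x)"
    using B by (auto simp: coeff_space_def fn_span_set)
  then obtain c where "\<And>x. (\<Sum>i<length fs. vec_index v i * (fs ! i) x) =
      (\<Sum>i<length fs. vec_index (B *\<^sub>v Matrix.vec r c) i * (fs ! i) x)"
    unfolding linear_combination_fn_mult[OF B] by blast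
  then have "vec_index v i = vec_index (B *\<^sub>v Matrix.vec r c) i" if "i < length fs" for i
    using fn_indepD[OF fs] that by blast
  then have "v = B *\<^sub>v Matrix.vec r c" using v B by (intro eq_vecI) auto
  then show "v \<in> (\<lambda>w. B *\<^sub>v w) ` carrier_vec r" by simp
next
  fix v assume "v \<in> (\<lambda>w. B *\<^sub>v w) ` carrier_vec r"
  then obtain w where w: "w \<in> carrier_vec r" and v: "v = B *\<^sub>v w" by auto
  have w': "Matrix.vec r (vec_index w) = w" using w by auto
  have "(\<Sum>i<length fs. vec_index v i * (fs ! i) x) =
      (\<Sum>j<r. vec_index w j * (fn_mult fs B ! j) x)" for x
    unfolding linear_combination_fn_mult[OF B] v w' ..
  moreover have "v \<in> carrier_vec (length fs)" unfolding v using B w by (rule mult_mat_vec_carrier)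
  moreover have "length (fn_mult fs B) = r" using B by simp
  ultimately show "v \<in> coeff_space fs (fn_span (set (fn_mult fs B)))"
    unfolding coeff_space_def fn_span_set by blast
qed

section \<open>Orthonormal columns\<close>

text \<open>
  Column spaces as images: from here on, spans are handled by matrix algebra.
\<close>

lemma vec_span_cols:
  assumes "M \<in> carrier_mat N r"
  shows "vec_span N (set (cols M)) = (\<lambda>w. M *\<^sub>v w) ` carrier_vec r"
  using vec_space.col_space_eq[OF assms] assms
  unfolding vec_span_def vec_space.col_space_def by auto

lemma vec_span_superset:
  assumes "A \<subseteq> carrier_vec N"
  shows "A \<subseteq> vec_span N A"
proof -
  interpret vec_space "TYPE(real)" N .
  show ?thesis unfolding vec_span_def by (rule in_own_span[OF assms])
qed

lemma gram_eq_one_iff: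
  fixes M :: "real mat"
  assumes "M \<in> carrier_mat N r"
  shows "M\<^sup>T * M = 1\<^sub>m r \<longleftrightarrow> (\<forall>i<r. \<forall>j<r. col M i \<bullet> col M j = (if i = j then 1 else 0))"
proof -
  have dims: "dim_row (M\<^sup>T * M) = r" "dim_col (M\<^sup>T * M) = r" using assms by auto
  have entry: "(M\<^sup>T * M) $$ (i, j) = col M i \<bullet> col M j" if "i < r" "j < r" for i j
    using that assms by simp
  show ?thesis
    unfolding mat_eq_iff using dims entry by simp
qed

lemma orthonormal_basis_cols:
  assumes M: "M \<in> carrier_mat N r" and gram: "M\<^sup>T * M = 1\<^sub>m r"
  shows "orthonormal_basis N (cols M) ((\<lambda>w. M *\<^sub>v w) ` carrier_vec r)"
proof -
  interpret vec_space "TYPE(real)" N .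
  have Mt: "M\<^sup>T \<in> carrier_mat r N" using M by simp
  have ip: "col M i \<bullet> col M j = (if i = j then 1 else 0)" if "i < r" "j < r" for i j
    using that gram by (simp add: gram_eq_one_iff[OF M])
  have d: "distinct (cols M)"
    unfolding distinct_conv_nth
  proof (intro allI impI notI)
    fix i j assume "i < length (cols M)" "j < length (cols M)" "i \<noteq> j" "cols M ! i = cols M ! j"
    then show False using ip[of i j] ip[of i i] M by simp
  qed
  have "\<not> lin_dep (set (cols M))"
  proof
    assume "lin_dep (set (cols M))"
    then obtain v where v: "v \<in> carrier_vec r" "v \<noteq> 0\<^sub>v r" "M *\<^sub>v v = 0\<^sub>v N"
      using lin_depE[OF M _ d] by blast
    have "v = (M\<^sup>T * M) *\<^sub>v v" using gram v by simp
    also have "\<dots> = M\<^sup>T *\<^sub>v (M *\<^sub>v v)" by (rule assoc_mult_mat_vec[OF Mt M v(1)])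
    also have "\<dots> = 0\<^sub>v r" unfolding v(3) using M by (intro eq_vecI) auto
    finally show False using v by simp
  qed
  then show ?thesis
    unfolding orthonormal_basis_def vec_dependent_def vec_span_cols[OF M]
    using ip d M cols_dim[of M] by auto
qed

lemma orthonormal_basis_gram:
  assumes "orthonormal_basis N (cols M) B" and M: "M \<in> carrier_mat N r"
  shows "M\<^sup>T * M = 1\<^sub>m r"
  using assms unfolding gram_eq_one_iff[OF M] orthonormal_basis_def by simp

text \<open>
  The matrix \<open>U U\<^sup>T\<close> acts as the identity on the column space of \<open>U\<close>, hence \<open>M = U (U\<^sup>T M)\<close>, and
  \<open>Q = U\<^sup>T M\<close> inherits \<open>Q\<^sup>T Q = M\<^sup>T M\<close>. As both matrices have \<open>r\<close> columns, \<open>Q\<close> is square and therefore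
  orthogonal, so that the two column spaces coincide.
\<close>

lemma orthonormal_cols_factor:
  fixes U M :: "real mat"
  assumes U: "U \<in> carrier_mat N r" and M: "M \<in> carrier_mat N r"
    and UU: "U\<^sup>T * U = 1\<^sub>m r" and MM: "M\<^sup>T * M = 1\<^sub>m r"
    and sub: "set (cols M) \<subseteq> (\<lambda>w. U *\<^sub>v w) ` carrier_vec r"
  obtains Q where "Q \<in> carrier_mat r r" "Q\<^sup>T * Q = 1\<^sub>m r" "M = U * Q"
proof
  have Ut: "U\<^sup>T \<in> carrier_mat r N" and Mt: "M\<^sup>T \<in> carrier_mat r N" using U M by auto
  let ?Q = "U\<^sup>T * M"
  show Q: "?Q \<in> carrier_mat r r" using Ut M by (rule mult_carrier_mat)
  show eq: "M = U * ?Q"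
  proof (rule mat_col_eqI)
    fix j assume "j < dim_col (U * ?Q)"
    then have j: "j < r" using M by simp
    then have "col M j \<in> set (cols M)" using M by (simp add: cols_def)
    then obtain w where w: "w \<in> carrier_vec r" "col M j = U *\<^sub>v w" using sub by auto
    have "col (U * ?Q) j = U *\<^sub>v (U\<^sup>T *\<^sub>v col M j)"
      using j by (simp add: col_mult2[OF U Q] col_mult2[OF Ut M])
    also have "U\<^sup>T *\<^sub>v col M j = w"
      unfolding w(2) assoc_mult_mat_vec[OF Ut U w(1), symmetric] UU using w by simp
    finally show "col M j = col (U * ?Q) j" using w by simp
  qed (use U M in auto)
  have "?Q\<^sup>T * ?Q = M\<^sup>T * U * ?Q" using transpose_mult[OF Ut M] by simp
  also have "\<dots> = M\<^sup>T * (U * ?Q)" by (rule assoc_mult_mat[OF Mt U Q])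
  finally show "?Q\<^sup>T * ?Q = 1\<^sub>m r" using eq MM by simp
qed

lemma gram_mult:
  fixes A B :: "real mat"
  assumes A: "A \<in> carrier_mat a b" and B: "B \<in> carrier_mat b c"
    and AA: "A\<^sup>T * A = 1\<^sub>m b" and BB: "B\<^sup>T * B = 1\<^sub>m c"
  shows "(A * B)\<^sup>T * (A * B) = 1\<^sub>m c"
proof -
  have At: "A\<^sup>T \<in> carrier_mat b a" and Bt: "B\<^sup>T \<in> carrier_mat c b" using A B by auto
  have "(A * B)\<^sup>T * (A * B) = B\<^sup>T * A\<^sup>T * (A * B)" by (simp only: transpose_mult[OF A B])
  also have "\<dots> = B\<^sup>T * (A\<^sup>T * (A * B))"
    by (rule assoc_mult_mat[OF Bt At mult_carrier_mat[OF A B]])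
  also have "A\<^sup>T * (A * B) = B"
    unfolding assoc_mult_mat[OF At A B, symmetric] AA using B by simp
  finally show ?thesis using BB by simp
qed

lemma gram_kron_id:
  assumes A: "A \<in> carrier_mat a b" and AA: "A\<^sup>T * A = 1\<^sub>m b"
  shows "(kron_id A n)\<^sup>T * kron_id A n = 1\<^sub>m (b * n)"
  using kron_id_mult[of "A\<^sup>T" b a A b n] A AA by (simp add: transpose_kron_id kron_id_one)

lemma orthogonal_mat_transpose:
  fixes Q :: "real mat"
  assumes "Q \<in> carrier_mat n n" "Q\<^sup>T * Q = 1\<^sub>m n"
  shows "Q * Q\<^sup>T = 1\<^sub>m n"
  using mat_mult_left_right_inverse[of "Q\<^sup>T" n Q] assms by simp

text \<open>
  The inverse \<open>Q\<^sup>T\<close> recovers \<open>fs\<close>, so the trivial inclusion applies in both directions.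
\<close>

lemma fn_span_fn_mult_orthogonal:
  assumes Q: "Q \<in> carrier_mat (length fs) (length fs)" and QQ: "Q\<^sup>T * Q = 1\<^sub>m (length fs)"
  shows "fn_span (set (fn_mult fs Q)) = fn_span (set fs)"
proof -
  have sub: "fn_span (set (fn_mult fs Q)) \<subseteq> fn_span (set fs)"
    if "Q \<in> carrier_mat (length fs) (length fs)" for fs :: "('a \<Rightarrow> real) list" and Q
  proof
    fix f assume "f \<in> fn_span (set (fn_mult fs Q))"
    moreover have "length (fn_mult fs Q) = length fs" using that by simp
    ultimately obtain c where "\<And>x. f x = (\<Sum>j<length fs. c j * (fn_mult fs Q ! j) x)"
      unfolding fn_span_set by (simp only: mem_Collect_eq) blast
    then show "f \<in> fn_span (set fs)"
      unfolding fn_span_set linear_combination_fn_mult[OF that] by blast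
  qed
  have Qt: "Q\<^sup>T \<in> carrier_mat (length fs) (length fs)" using Q by simp
  have "fn_mult (fn_mult fs Q) Q\<^sup>T = fs"
    unfolding fn_mult_fn_mult[OF Q Qt] orthogonal_mat_transpose[OF Q QQ] by (rule fn_mult_one)
  then show ?thesis using sub[OF Q] sub[of "Q\<^sup>T" "fn_mult fs Q"] Q by auto
qed

section \<open>Eigenspaces and singular value decompositions\<close>

abbreviation diag_matrix :: "nat \<Rightarrow> (nat \<Rightarrow> real) \<Rightarrow> real mat" where
  "diag_matrix n d \<equiv> mat n n (\<lambda>(i, j). if i = j then d i else 0)"

abbreviation left_cols :: "real mat \<Rightarrow> nat \<Rightarrow> real mat" where
  "left_cols P r \<equiv> mat (dim_row P) r (\<lambda>ij. P $$ ij)"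

lemma rev_sort_decreasing: "rev (sort (map d [0..<n])) = map d [0..<n]"
  if "\<And>i j. i \<le> j \<Longrightarrow> j < n \<Longrightarrow> d j \<le> (d i :: real)"
proof -
  have "sorted (rev (map d [0..<n]))"
    using that by (auto simp: sorted_iff_nth_mono rev_nth)
  then have "sort (rev (map d [0..<n])) = rev (map d [0..<n])" by (rule sort_key_id_if_sorted[of "\<lambda>x. x", simplified])
  moreover have "sort (rev (map d [0..<n])) = sort (map d [0..<n])"
    by (rule properties_for_sort) simp_all
  ultimately show ?thesis by (metis rev_rev_ident)
qed

text \<open>
  Similarity to a diagonal matrix factors the characteristic polynomial into linear factors; as \<open>d\<close> is
  decreasing, its enumeration is the decreasing one with multiplicities.
\<close>

lemma eigenvalue_list_diagonalized:
  assumes P: "P \<in> carrier_mat n n" and PP: "P\<^sup>T * P = 1\<^sub>m n"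
    and C: "C = P * diag_matrix n d * P\<^sup>T"
    and d: "\<And>i j. i \<le> j \<Longrightarrow> j < n \<Longrightarrow> d j \<le> d i"
  shows "eigenvalue_list C = map d [0..<n]"
proof -
  let ?D = "diag_matrix n d"
  have "similar_mat C ?D"
    by (rule similar_matI[of _ _ P "P\<^sup>T" n])
      (use P PP C orthogonal_mat_transpose[OF P PP] in auto)
  then have "char_poly C = char_poly ?D" by (rule char_poly_similar)
  also have "\<dots> = (\<Prod>a\<leftarrow>diag_mat ?D. [:- a, 1:])"
    by (rule char_poly_upper_triangular[of _ n]) (auto simp: upper_triangular_def)
  also have "diag_mat ?D = map d [0..<n]" by (auto simp: diag_mat_def)
  finally have cp: "char_poly C = (\<Prod>a\<leftarrow>map d [0..<n]. [:- a, 1:])" .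
  have "proots (\<Prod>a\<leftarrow>xs. [:- a, 1:]) = mset xs" for xs :: "real list"
  proof (induction xs)
    case (Cons x xs)
    have "(\<Prod>a\<leftarrow>xs. [:- a, 1:]) \<noteq> 0" by (auto simp: prod_list_zero_iff)
    then show ?case using Cons by (simp add: proots_mult del: mult_pCons_left)
  qed simp
  then show ?thesis unfolding eigenvalue_list_def cp
    by (simp only: sorted_list_of_multiset_mset) (rule rev_sort_decreasing, rule d)
qed

text \<open>
  Column \<open>j\<close> of \<open>P\<close> is an eigenvector for \<open>d j\<close>, which is among the first \<open>r\<close> eigenvalues if \<open>j < r\<close>.
\<close>

lemma diagonalized_leading_cols:
  assumes P: "P \<in> carrier_mat n n" and PP: "P\<^sup>T * P = 1\<^sub>m n"
    and C: "C = P * diag_matrix n d * P\<^sup>T"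
    and d: "\<And>i j. i \<le> j \<Longrightarrow> j < n \<Longrightarrow> d j \<le> d i"
    and r: "r \<le> n"
  shows "set (cols (left_cols P r)) \<subseteq> leading_eigenspace C r"
proof
  let ?D = "diag_matrix n d"
  have Pt: "P\<^sup>T \<in> carrier_mat n n" and D: "?D \<in> carrier_mat n n" using P by auto
  have PD: "P * ?D \<in> carrier_mat n n" using P D by (rule mult_carrier_mat)
  have Cn: "C \<in> carrier_mat n n" unfolding C using PD Pt by (rule mult_carrier_mat)
  fix v assume "v \<in> set (cols (left_cols P r))"
  then obtain j where j: "j < r" and v: "v = col (left_cols P r) j" by (auto simp: cols_def)
  then have jn: "j < n" and v: "v = col P j" using r P by (auto simp: col_def)
  have "C * P = P * ?D"
    unfolding C assoc_mult_mat[OF PD Pt P] PP using PD by simp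
  then have "C *\<^sub>v v = col (P * ?D) j"
    using col_mult2[OF Cn P jn] v by simp
  also have "\<dots> = d j \<cdot>\<^sub>v v"
  proof (rule eq_vecI)
    fix i assume "i < dim_vec (d j \<cdot>\<^sub>v v)"
    then have i: "i < n" using v P by simp
    have "vec_index (col (P * ?D) j) i = (P * ?D) $$ (i, j)" using i jn P by simp
    also have "\<dots> = (\<Sum>k<n. P $$ (i, k) * ?D $$ (k, j))"
      by (rule index_mat_mult_sum[OF P D i jn])
    also have "\<dots> = (\<Sum>k<n. if k = j then P $$ (i, k) * d k else 0)"
      using jn by (intro sum.cong) auto
    also have "\<dots> = vec_index (d j \<cdot>\<^sub>v v) i" using i jn P v by simp
    finally show "vec_index (col (P * ?D) j) i = vec_index (d j \<cdot>\<^sub>v v) i" .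
  qed (use P v in simp)
  finally have ev: "C *\<^sub>v v = d j \<cdot>\<^sub>v v" .
  have vn: "v \<in> carrier_vec n" unfolding v by (rule col_carrier_vec[OF jn P])
  \<comment> \<open>columns of an orthogonal matrix are nonzero, as eigenvectors must be\<close>
  have "v \<bullet> v = 1" using PP[unfolded gram_eq_one_iff[OF P]] jn unfolding v by simp
  then have "v \<noteq> 0\<^sub>v n" by auto
  then have "eigenvector C v (d j)" using ev vn Cn by (simp add: eigenvector_def)
  moreover have "d j \<in> set (take r (eigenvalue_list C))"
  proof -
    have "eigenvalue_list C = map d [0..<n]"
      by (rule eigenvalue_list_diagonalized[OF P PP C d])
    then show ?thesis using j r by (simp add: take_map)
  qed
  ultimately have "v \<in> {v. \<exists>e \<in> set (take r (eigenvalue_list C)). eigenvector C v e}" by blast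
  moreover have "{v. \<exists>e \<in> set (take r (eigenvalue_list C)). eigenvector C v e}
      \<subseteq> carrier_vec (dim_row C)"
    unfolding eigenvector_def by blast
  ultimately show "v \<in> leading_eigenspace C r"
    unfolding leading_eigenspace_def using vec_span_superset by blast
qed

lemma truncated_svd_orthonormal:
  assumes svd: "truncated_svd A r U S V"
  shows "U \<in> carrier_mat (dim_row A) r" "U\<^sup>T * U = 1\<^sub>m r" "r \<le> dim_row A"
proof -
  obtain U' S' V' where sv: "is_svd A U' S' V'" and U: "U = mat (dim_row A) r (\<lambda>ij. U' $$ ij)"
    and r: "r \<le> dim_row A"
    using svd unfolding truncated_svd_def by auto
  have U': "U' \<in> carrier_mat (dim_row A) (dim_row A)" "U'\<^sup>T * U' = 1\<^sub>m (dim_row A)"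
    using sv[unfolded is_svd_def Let_def] by blast+
  show Uc: "U \<in> carrier_mat (dim_row A) r" and "r \<le> dim_row A" using U r by auto
  have col: "col U k = col U' k" if "k < r" for k
    using that r U' U by (intro eq_vecI) auto
  show "U\<^sup>T * U = 1\<^sub>m r"
    unfolding gram_eq_one_iff[OF Uc]
    using U'(2)[unfolded gram_eq_one_iff[OF U'(1)]] r by (simp add: col)
qed

text \<open>
  The columns of \<open>U\<close> are among those of the full orthogonal factor \<open>U'\<close>, so \<open>U\<^sup>T A\<close> is formed by the first
  \<open>r\<close> rows of \<open>S' V'\<^sup>T\<close>. Since \<open>S'\<close> is diagonal, these involve only the first \<open>r\<close> columns of \<open>V'\<close>:
  truncation loses nothing on the leading part.
\<close>

lemma truncated_svd_right:
  assumes svd: "truncated_svd A r U S V"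
  shows "S * V\<^sup>T = U\<^sup>T * A"
proof -
  define a b where "a = dim_row A" and "b = dim_col A"
  obtain U' S' V' where sv: "is_svd A U' S' V'" and U: "U = mat a r (\<lambda>ij. U' $$ ij)"
    and S: "S = mat r r (\<lambda>ij. S' $$ ij)" and V: "V = mat b r (\<lambda>ij. V' $$ ij)"
    and r: "r \<le> a" "r \<le> b"
    using svd unfolding truncated_svd_def a_def b_def by auto
  have U': "U' \<in> carrier_mat a a" "U'\<^sup>T * U' = 1\<^sub>m a" and S': "S' \<in> carrier_mat a b"
    and V': "V' \<in> carrier_mat b b" and A: "A = U' * S' * V'\<^sup>T"
    and diag: "\<And>i j. i < a \<Longrightarrow> j < b \<Longrightarrow> i \<noteq> j \<Longrightarrow> S' $$ (i, j) = 0"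
    using sv[unfolded is_svd_def Let_def, folded a_def b_def] by blast+
  have V't: "V'\<^sup>T \<in> carrier_mat b b" and U't: "U'\<^sup>T \<in> carrier_mat a a" using V' U' by auto
  have SV': "S' * V'\<^sup>T \<in> carrier_mat a b" using S' V't by (rule mult_carrier_mat)
  have Ac: "A \<in> carrier_mat a b" by (auto simp: a_def b_def)
  have UA: "U'\<^sup>T * A = S' * V'\<^sup>T"
    unfolding A assoc_mult_mat[OF U'(1) S' V't] assoc_mult_mat[OF U't U'(1) SV', symmetric] U'(2)
    by (rule left_mult_one_mat[OF SV'])
  have Uc: "U\<^sup>T \<in> carrier_mat r a" and Sc: "S \<in> carrier_mat r r" and Vc: "V\<^sup>T \<in> carrier_mat r b"
    using U S V by auto
  show ?thesis
  proof (rule eq_matI)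
    fix i j assume "i < dim_row (U\<^sup>T * A)" "j < dim_col (U\<^sup>T * A)"
    then have i: "i < r" and j: "j < b" using Uc Ac by auto
    then have ia: "i < a" and ib: "i < b" using r by auto
    \<comment> \<open>row \<open>i\<close> of \<open>S'\<close> has at most one nonzero entry, in column \<open>i\<close>\<close>
    have diag_sum: "(\<Sum>k<n. S' $$ (i, k) * V' $$ (j, k)) = S' $$ (i, i) * V' $$ (j, i)"
      if n: "n \<le> b" "i < n" for n
    proof -
      have "(\<Sum>k<n. S' $$ (i, k) * V' $$ (j, k)) =
          (\<Sum>k<n. if k = i then S' $$ (i, k) * V' $$ (j, k) else 0)"
        using n diag[OF ia] by (intro sum.cong) auto
      then show ?thesis using n by simp
    qed
    have "(U\<^sup>T * A) $$ (i, j) = (\<Sum>k<a. U\<^sup>T $$ (i, k) * A $$ (k, j))"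
      by (rule index_mat_mult_sum[OF Uc Ac i j])
    also have "\<dots> = (\<Sum>k<a. U'\<^sup>T $$ (i, k) * A $$ (k, j))"
      using U U' i ia by (intro sum.cong) auto
    also have "\<dots> = (U'\<^sup>T * A) $$ (i, j)"
      by (rule index_mat_mult_sum[OF U't Ac ia j, symmetric])
    also have "\<dots> = (\<Sum>k<b. S' $$ (i, k) * V'\<^sup>T $$ (k, j))"
      unfolding UA by (rule index_mat_mult_sum[OF S' V't ia j])
    also have "\<dots> = (\<Sum>k<b. S' $$ (i, k) * V' $$ (j, k))"
      using V' j by (intro sum.cong) auto
    also have "\<dots> = (\<Sum>k<r. S' $$ (i, k) * V' $$ (j, k))"
      using diag_sum[of b] diag_sum[of r] ib i r by simp
    also have "\<dots> = (\<Sum>k<r. S $$ (i, k) * V\<^sup>T $$ (k, j))"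
      using S V i j by (intro sum.cong) auto
    also have "\<dots> = (S * V\<^sup>T) $$ (i, j)"
      by (rule index_mat_mult_sum[OF Sc Vc i j, symmetric])
    finally show "(S * V\<^sup>T) $$ (i, j) = (U\<^sup>T * A) $$ (i, j)" ..
  qed (use Uc Sc Vc Ac in auto)
qed

text \<open>
  From \<open>A = U' S' V'\<^sup>T\<close> one gets \<open>A A\<^sup>T = U' (S' S'\<^sup>T) U'\<^sup>T\<close>: the SVD supplies a decreasing spectral
  decomposition of the covariance matrix when \<open>A\<close> holds the values of functions at the data points.
\<close>

lemma truncated_svd_gram_diagonalized:
  assumes svd: "truncated_svd A r U S V"
  obtains P d where "P \<in> carrier_mat (dim_row A) (dim_row A)" "P\<^sup>T * P = 1\<^sub>m (dim_row A)"
    "U = left_cols P r" "\<forall>j<dim_row A. \<forall>i\<le>j. d j \<le> d i"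
    "A * A\<^sup>T = P * diag_matrix (dim_row A) d * P\<^sup>T"
proof -
  define a b where "a = dim_row A" and "b = dim_col A"
  obtain U' S' V' where sv: "is_svd A U' S' V'" and U: "U = mat a r (\<lambda>ij. U' $$ ij)"
    using svd unfolding truncated_svd_def a_def by auto
  have U': "U' \<in> carrier_mat a a" "U'\<^sup>T * U' = 1\<^sub>m a" and S': "S' \<in> carrier_mat a b"
    and V': "V' \<in> carrier_mat b b" and VV: "V'\<^sup>T * V' = 1\<^sub>m b" and Aeq: "A = U' * S' * V'\<^sup>T"
    and diag: "\<And>i j. i < a \<Longrightarrow> j < b \<Longrightarrow> i \<noteq> j \<Longrightarrow> S' $$ (i, j) = 0"
    and pos: "\<And>i. i < min a b \<Longrightarrow> 0 \<le> S' $$ (i, i)"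
    and dec: "\<And>i j. i \<le> j \<Longrightarrow> j < min a b \<Longrightarrow> S' $$ (j, j) \<le> S' $$ (i, i)"
    using sv[unfolded is_svd_def Let_def, folded a_def b_def] by blast+
  \<comment> \<open>\<open>A A\<^sup>T\<close> has further zero eigenvalues if \<open>A\<close> has more rows than columns\<close>
  define d where "d i = (if i < b then (S' $$ (i, i))\<^sup>2 else 0)" for i
  have ts: "U'\<^sup>T \<in> carrier_mat a a" "S'\<^sup>T \<in> carrier_mat b a" "V'\<^sup>T \<in> carrier_mat b b"
    using U' S' V' by auto
  have US: "U' * S' \<in> carrier_mat a b" using U'(1) S' by (rule mult_carrier_mat)
  have SU: "S'\<^sup>T * U'\<^sup>T \<in> carrier_mat b a" using ts(2,1) by (rule mult_carrier_mat)
  have SS: "S' * S'\<^sup>T = diag_matrix a d"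
  proof (rule eq_matI)
    fix i j assume "i < dim_row (diag_matrix a d)" "j < dim_col (diag_matrix a d)"
    then have i: "i < a" and j: "j < a" by auto
    have "(S' * S'\<^sup>T) $$ (i, j) = (\<Sum>k<b. S' $$ (i, k) * S'\<^sup>T $$ (k, j))"
      by (rule index_mat_mult_sum[OF S' ts(2) i j])
    also have "\<dots> = (\<Sum>k<b. if k = i then S' $$ (i, i) * S' $$ (j, i) else 0)"
      using S' i j diag[OF i] by (intro sum.cong) auto
    also have "\<dots> = diag_matrix a d $$ (i, j)"
      using i j diag[OF j, of i] by (auto simp: d_def power2_eq_square)
    finally show "(S' * S'\<^sup>T) $$ (i, j) = diag_matrix a d $$ (i, j)" .
  qed (use S' in auto)
  have At: "A\<^sup>T = V' * (S'\<^sup>T * U'\<^sup>T)"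
    unfolding Aeq transpose_mult[OF US ts(3)] transpose_mult[OF U'(1) S'] by simp
  have "A * A\<^sup>T = U' * S' * V'\<^sup>T * (V' * (S'\<^sup>T * U'\<^sup>T))" 
    by (subst At, subst Aeq) (rule refl)
  also have "\<dots> = U' * S' * (V'\<^sup>T * (V' * (S'\<^sup>T * U'\<^sup>T)))"
    by (rule assoc_mult_mat[OF US ts(3) mult_carrier_mat[OF V' SU]])
  also have "V'\<^sup>T * (V' * (S'\<^sup>T * U'\<^sup>T)) = S'\<^sup>T * U'\<^sup>T"
    unfolding assoc_mult_mat[OF ts(3) V' SU, symmetric] VV
    by (rule left_mult_one_mat[OF SU])
  also have "U' * S' * (S'\<^sup>T * U'\<^sup>T) = U' * (S' * (S'\<^sup>T * U'\<^sup>T))"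
    by (rule assoc_mult_mat[OF U'(1) S' SU])
  also have "\<dots> = U' * (S' * S'\<^sup>T * U'\<^sup>T)"
    by (simp only: assoc_mult_mat[OF S' ts(2,1)])
  also have "\<dots> = U' * (S' * S'\<^sup>T) * U'\<^sup>T"
    by (rule assoc_mult_mat[OF U'(1) mult_carrier_mat[OF S' ts(2)] ts(1), symmetric])
  finally have "A * A\<^sup>T = U' * diag_matrix a d * U'\<^sup>T" unfolding SS .
  moreover have "d j \<le> d i" if "i \<le> j" "j < a" for i j
  proof (cases "j < b")
    case True
    then show ?thesis
      using that dec[of i j] pos[of j] power_mono[of "S' $$ (j, j)" "S' $$ (i, i)" 2]
      by (simp add: d_def)
  qed (simp add: d_def)
  ultimately show thesis using that[of U' d] U U' by (simp add: a_def)
qed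

text \<open>
  The induction step of the comparison. The tuples \<open>\<eta>\<close> and \<open>fn_mult \<eta> K\<close> describe the same space in
  orthonormal coordinates related by \<open>K\<close>. A diagonalization of the covariance of the second tuple by \<open>P\<close>
  yields one of the covariance of the first by \<open>K P\<close>, so \<open>K U\<close> consists of leading eigenvectors of the latter,
  which lie in the column space of \<open>U0\<close>.
\<close>

lemma leading_singular_vectors_change_of_basis:
  assumes K: "K \<in> carrier_mat (length \<eta>) (length \<eta>)" and KK: "K\<^sup>T * K = 1\<^sub>m (length \<eta>)"
    and svd: "truncated_svd (eval_mat (fn_mult \<eta> K) X) r U S V"
    and U0: "U0 \<in> carrier_mat (length \<eta>) r"
    and basis: "orthonormal_basis (length \<eta>) (cols U0) (leading_eigenspace (empirical_cov \<eta> X) r)"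
  obtains Q where "Q \<in> carrier_mat r r" "Q\<^sup>T * Q = 1\<^sub>m r" "K * U = U0 * Q"
proof -
  let ?N = "length \<eta>" and ?A = "eval_mat (fn_mult \<eta> K) X"
  have dimA: "dim_row ?A = ?N" using K by (simp add: eval_mat_def)
  obtain P d where P: "P \<in> carrier_mat ?N ?N" and PP: "P\<^sup>T * P = 1\<^sub>m ?N" and UP: "U = left_cols P r"
    and d: "\<forall>j<?N. \<forall>i\<le>j. d j \<le> d i"
    and AA: "?A * ?A\<^sup>T = P * diag_matrix ?N d * P\<^sup>T"
    by (rule truncated_svd_gram_diagonalized[OF svd, unfolded dimA])
  have U: "U \<in> carrier_mat ?N r" and UU: "U\<^sup>T * U = 1\<^sub>m r" and r: "r \<le> ?N"
    using truncated_svd_orthonormal[OF svd] unfolding dimA by auto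
  define c where "c = 1 / real (length X)"
  have c: "c \<ge> 0" by (simp add: c_def)
  have Pt: "P\<^sup>T \<in> carrier_mat ?N ?N" and Kt: "K\<^sup>T \<in> carrier_mat ?N ?N" using P K by auto
  let ?D = "diag_matrix ?N d" and ?E = "diag_matrix ?N (\<lambda>i. c * d i)"
  have D: "?D \<in> carrier_mat ?N ?N" and E: "?E \<in> carrier_mat ?N ?N" by auto
  have PD: "P * ?D \<in> carrier_mat ?N ?N" and PE: "P * ?E \<in> carrier_mat ?N ?N"
    using P D E mult_carrier_mat by blast+
  have KP: "K * P \<in> carrier_mat ?N ?N" using K P by (rule mult_carrier_mat)
  have cD: "c \<cdot>\<^sub>m ?D = ?E" by (rule eq_matI) auto
  have C: "empirical_cov (fn_mult \<eta> K) X = P * ?E * P\<^sup>T"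
    unfolding empirical_cov_eq_eval_mat AA c_def[symmetric] cD[symmetric]
      mult_smult_distrib[OF P D] mult_smult_assoc_mat[OF PD Pt] ..
  have C0: "empirical_cov \<eta> X \<in> carrier_mat ?N ?N" by (rule empirical_cov_carrier)
  \<comment> \<open>undo the congruence by \<open>K\<close>, which is orthogonal\<close>
  have "K * (K\<^sup>T * empirical_cov \<eta> X * K) * K\<^sup>T = empirical_cov \<eta> X"
  proof -
    have KtC: "K\<^sup>T * empirical_cov \<eta> X \<in> carrier_mat ?N ?N" using Kt C0 by (rule mult_carrier_mat)
    have "K * (K\<^sup>T * empirical_cov \<eta> X * K) = K * (K\<^sup>T * empirical_cov \<eta> X) * K"
      by (rule assoc_mult_mat[OF K KtC K, symmetric])
    also have "K * (K\<^sup>T * empirical_cov \<eta> X) = empirical_cov \<eta> X"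
      unfolding assoc_mult_mat[OF K Kt C0, symmetric] orthogonal_mat_transpose[OF K KK]
      by (rule left_mult_one_mat[OF C0])
    finally have "K * (K\<^sup>T * empirical_cov \<eta> X * K) * K\<^sup>T = empirical_cov \<eta> X * K * K\<^sup>T" by simp
    then show ?thesis
      unfolding assoc_mult_mat[OF C0 K Kt] orthogonal_mat_transpose[OF K KK]
      by (simp only: right_mult_one_mat[OF C0])
  qed
  then have "empirical_cov \<eta> X = K * (P * ?E * P\<^sup>T) * K\<^sup>T"
    using empirical_cov_fn_mult[OF K, of X] C by simp
  also have "\<dots> = K * (P * ?E) * P\<^sup>T * K\<^sup>T"
    by (simp only: assoc_mult_mat[OF K PE Pt])
  also have "\<dots> = K * P * ?E * P\<^sup>T * K\<^sup>T"
    by (simp only: assoc_mult_mat[OF K P E])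
  also have "\<dots> = K * P * ?E * (P\<^sup>T * K\<^sup>T)"
    by (rule assoc_mult_mat[OF mult_carrier_mat[OF KP E] Pt Kt])
  also have "P\<^sup>T * K\<^sup>T = (K * P)\<^sup>T" by (rule transpose_mult[OF K P, symmetric])
  finally have C': "empirical_cov \<eta> X = K * P * ?E * (K * P)\<^sup>T" .
  have KU: "K * U \<in> carrier_mat ?N r" using K U by (rule mult_carrier_mat)
  have "K * U = left_cols (K * P) r"
  proof (rule eq_matI)
    fix i j assume "i < dim_row (left_cols (K * P) r)" "j < dim_col (left_cols (K * P) r)"
    then have i: "i < ?N" and j: "j < r" using K by auto
    have jN: "j < ?N" using j r by simp
    have "(K * U) $$ (i, j) = (\<Sum>k<?N. K $$ (i, k) * U $$ (k, j))"
      by (rule index_mat_mult_sum[OF K U i j])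
    also have "\<dots> = (\<Sum>k<?N. K $$ (i, k) * P $$ (k, j))"
      using P j unfolding UP by (intro sum.cong) auto
    also have "\<dots> = (K * P) $$ (i, j)" by (rule index_mat_mult_sum[OF K P i jN, symmetric])
    finally show "(K * U) $$ (i, j) = left_cols (K * P) r $$ (i, j)" using i j K by simp
  qed (use K U in auto)
  moreover have "set (cols (left_cols (K * P) r)) \<subseteq> leading_eigenspace (empirical_cov \<eta> X) r"
    by (rule diagonalized_leading_cols[OF KP gram_mult[OF K P KK PP] C' _ r])
      (use c d in \<open>auto intro: mult_left_mono\<close>)
  moreover have "leading_eigenspace (empirical_cov \<eta> X) r = (\<lambda>w. U0 *\<^sub>v w) ` carrier_vec r"
    using basis unfolding orthonormal_basis_def vec_span_cols[OF U0] by simp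
  ultimately have "set (cols (K * U)) \<subseteq> (\<lambda>w. U0 *\<^sub>v w) ` carrier_vec r" by simp
  from orthonormal_cols_factor[OF U0 KU orthonormal_basis_gram[OF basis U0] gram_mult[OF K U KK UU] this]
  show thesis using that by metis
qed

section \<open>Tensor trains and data tensors\<close>

lemma mode_dims_Suc: "mode_dims \<psi> (Suc k) = mode_dims \<psi> k @ [length (\<psi> (Suc k))]"
  by (simp add: mode_dims_def)

lemma length_mode_dims [simp]: "length (mode_dims \<psi> k) = k"
  by (simp add: mode_dims_def)

lemma length_product_basis [simp]:
  "length (product_basis \<psi> k) = length (multi_indices (mode_dims \<psi> k))"
  by (simp add: product_basis_def)

lemma product_basis_0: "product_basis \<psi> 0 = [\<lambda>_. 1]"
  by (simp add: product_basis_def mode_dims_def)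

text \<open>
  The recursive description of the product basis, matching the one of the spectral recursion; the
  lexicographic ordering is the one used by \<^const>\<open>vec_tensor\<close>.
\<close>

lemma product_basis_Suc:
  "product_basis \<psi> (Suc k) = vec_tensor (product_basis \<psi> k) (\<psi> (Suc k))"
proof (rule nth_equalityI)
  let ?N = "length (multi_indices (mode_dims \<psi> k))" and ?n = "length (\<psi> (Suc k))"
  fix i assume "i < length (product_basis \<psi> (Suc k))"
  then have i: "i < ?N * ?n" by (simp add: mode_dims_Suc)
  note ib = div_mod_bounds[OF i]
  define ix where "ix = multi_indices (mode_dims \<psi> k) ! (i div ?n)"
  have ix: "length ix = k" using ib by (simp add: ix_def length_nth_multi_indices)
  show "product_basis \<psi> (Suc k) ! i = vec_tensor (product_basis \<psi> k) (\<psi> (Suc k)) ! i"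
  proof
    fix x
    have "(product_basis \<psi> (Suc k) ! i) x =
        (\<Prod>j=1..Suc k. (\<psi> j ! ((ix @ [i mod ?n]) ! (j - 1))) x)"
      using i by (simp add: product_basis_def mode_dims_Suc nth_multi_indices_snoc ix_def)
    also have "\<dots> = (\<Prod>j=1..k. (\<psi> j ! (ix ! (j - 1))) x) * (\<psi> (Suc k) ! (i mod ?n)) x"
    proof -
      have "(\<Prod>j=1..k. (\<psi> j ! ((ix @ [i mod ?n]) ! (j - 1))) x) =
          (\<Prod>j=1..k. (\<psi> j ! (ix ! (j - 1))) x)"
        using ix by (intro prod.cong) (auto simp: nth_append)
      then show ?thesis using ix by (simp add: nth_append)
    qed
    also have "\<dots> = (vec_tensor (product_basis \<psi> k) (\<psi> (Suc k)) ! i) x"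
      using i ib by (simp add: nth_vec_tensor product_basis_def ix_def)
    finally show "(product_basis \<psi> (Suc k) ! i) x =
        (vec_tensor (product_basis \<psi> k) (\<psi> (Suc k)) ! i) x" .
  qed
qed (simp add: mode_dims_Suc)

lemma unfolding_mat_last_carrier:
  "unfolding_mat (ns @ [n]) (length ns) T \<in> carrier_mat (length (multi_indices ns)) n"
  by (simp add: unfolding_mat_def Let_def multi_indices_single)

lemma index_unfolding_mat_last:
  "i < length (multi_indices ns) \<Longrightarrow> j < n \<Longrightarrow>
    unfolding_mat (ns @ [n]) (length ns) T $$ (i, j) = T (multi_indices ns ! i @ [j])"
  by (simp add: unfolding_mat_def Let_def multi_indices_single)

lemma core_unfolding2_carrier: "unfolding_mat [a, n, c] 2 T \<in> carrier_mat (a * n) c"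
  by (simp add: unfolding_mat_def Let_def multi_indices_single multi_indices_pair numeral_2_eq_2)

lemma index_core_unfolding2:
  "i < a * n \<Longrightarrow> j < c \<Longrightarrow> unfolding_mat [a, n, c] 2 T $$ (i, j) = T [i div n, i mod n, j]"
  by (simp add: unfolding_mat_def Let_def multi_indices_single multi_indices_pair numeral_2_eq_2)

lemma core_unfolding1_carrier: "unfolding_mat [a, n, c] 1 T \<in> carrier_mat a (n * c)"
  by (simp add: unfolding_mat_def Let_def multi_indices_single multi_indices_pair)

lemma index_core_unfolding1:
  "i < a \<Longrightarrow> j < n * c \<Longrightarrow> unfolding_mat [a, n, c] 1 T $$ (i, j) = T [i, j div c, j mod c]"
  by (simp add: unfolding_mat_def Let_def multi_indices_single multi_indices_pair)

lemma data_tensor_unfolding: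
  "unfolding_mat (mode_dims \<psi> p @ [length X]) p (data_tensor \<psi> p X) = eval_mat (product_basis \<psi> p) X"
  (is "?L = _")
proof -
  have eq: "?L = unfolding_mat (mode_dims \<psi> p @ [length X]) (length (mode_dims \<psi> p)) (data_tensor \<psi> p X)"
    by simp
  show ?thesis
  proof (rule eq_matI)
    fix i j assume "i < dim_row (eval_mat (product_basis \<psi> p) X)"
      "j < dim_col (eval_mat (product_basis \<psi> p) X)"
    then have i: "i < length (multi_indices (mode_dims \<psi> p))" and j: "j < length X"
      by (auto simp: eval_mat_def)
    define ix where "ix = multi_indices (mode_dims \<psi> p) ! i"
    have ix: "length ix = p" using i by (simp add: ix_def length_nth_multi_indices)
    have "?L $$ (i, j) = (\<Prod>k=1..p. (\<psi> k ! ((ix @ [j]) ! (k - 1))) (X ! j))"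
      unfolding eq index_unfolding_mat_last[OF i j] ix_def[symmetric]
      using ix by (simp add: data_tensor_def nth_append)
    also have "\<dots> = (\<Prod>k=1..p. (\<psi> k ! (ix ! (k - 1))) (X ! j))"
      using ix by (intro prod.cong) (auto simp: nth_append)
    also have "\<dots> = eval_mat (product_basis \<psi> p) X $$ (i, j)"
      using i j by (simp add: index_eval_mat product_basis_def ix_def)
    finally show "?L $$ (i, j) = eval_mat (product_basis \<psi> p) X $$ (i, j)" .
  qed (use unfolding_mat_last_carrier[of "mode_dims \<psi> p" "length X" "data_tensor \<psi> p X"]
    in \<open>auto simp: eval_mat_def\<close>)
qed

lemma sum_list_multi_indices_snoc:
  "(\<Sum>ls\<leftarrow>multi_indices (ns @ [n]). f ls) =
    (\<Sum>l<n. \<Sum>ls\<leftarrow>multi_indices ns. f (ls @ [l]))" for f :: "nat list \<Rightarrow> real"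
proof -
  have "(\<Sum>ls\<leftarrow>concat (map (\<lambda>xs. map (\<lambda>y. xs @ [y]) [0..<n]) xss). f ls) =
      (\<Sum>l<n. \<Sum>ls\<leftarrow>xss. f (ls @ [l]))" for xss
    by (induction xss)
      (simp_all add: sum.distrib interv_sum_list_conv_sum_set_nat lessThan_atLeast0 o_def)
  then show ?thesis by (simp add: multi_indices_def product_lists_snoc)
qed

text \<open>
  Splitting off the last core: the rank index \<open>l'\<close>, trailing in the shorter train, becomes the last
  summation index. The empty train is the scalar \<open>1\<close>, with the single rank index \<open>l\<^sub>0 = 0\<close>, so
  the recursion starts at \<open>k = 0\<close>.
\<close>

lemma partial_tt_Suc:
  assumes r0: "r 0 = 1" and ix: "length ix = k"
  shows "partial_tt r T (Suc k) (ix @ [i, l]) =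
    (\<Sum>l'<r k. partial_tt r T k (ix @ [l']) * T (Suc k) [l', i, l])"
proof (cases "k = 0")
  case True
  then show ?thesis using r0 ix by (simp add: partial_tt_def)
next
  case False
  then have k: "k \<ge> 1" by simp
  have dims: "map r [1..<Suc k] = map r [1..<k] @ [r k]" using k by simp
  define factor where "factor L I j = T j [L ! (j - 1), I ! (j - 1), L ! j]" for L I j
  have tt: "partial_tt r T k' jx =
      (\<Sum>ls\<leftarrow>multi_indices (map r [1..<k']). \<Prod>j=1..k'. factor (0 # ls @ [jx ! k']) jx j)" for k' jx
    by (simp add: partial_tt_def factor_def)
  have step: "(\<Prod>j=1..Suc k. factor (0 # (ls @ [l']) @ [l]) (ix @ [i, l]) j) =
      (\<Prod>j=1..k. factor (0 # ls @ [l']) (ix @ [l']) j) * T (Suc k) [l', i, l]"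
    if "ls \<in> set (multi_indices (map r [1..<k]))" for ls l'
  proof -
    define L where "L = 0 # ls @ [l']"
    have L: "length L = Suc k" "L ! k = l'"
      using length_in_multi_indices[OF that] k by (auto simp: L_def nth_append nth_Cons')
    have ext: "0 # (ls @ [l']) @ [l] = L @ [l]" by (simp add: L_def)
    have "factor (L @ [l]) (ix @ [i, l]) j = factor L (ix @ [l']) j" if "j \<in> {1..k}" for j
    proof -
      have "j - 1 < length ix" "j - 1 < length L" "j < length L" using that L ix by auto
      then show ?thesis by (simp add: factor_def nth_append_left)
    qed
    then have "(\<Prod>j=1..k. factor (L @ [l]) (ix @ [i, l]) j) = (\<Prod>j=1..k. factor L (ix @ [l']) j)"
      by (intro prod.cong) auto
    moreover have "factor (L @ [l]) (ix @ [i, l]) (Suc k) = T (Suc k) [l', i, l]"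
      using L ix by (simp add: factor_def nth_append)
    ultimately show ?thesis unfolding ext L_def[symmetric] by simp
  qed
  have last: "(ix @ [i, l]) ! Suc k = l" "\<And>l'. (ix @ [l']) ! k = l'"
    using ix by (simp_all add: nth_append)
  have "partial_tt r T (Suc k) (ix @ [i, l]) = (\<Sum>l'<r k. \<Sum>ls\<leftarrow>multi_indices (map r [1..<k]).
        (\<Prod>j=1..k. factor (0 # ls @ [l']) (ix @ [l']) j) * T (Suc k) [l', i, l])"
    unfolding tt dims sum_list_multi_indices_snoc last
    by (intro sum.cong refl arg_cong[where f = sum_list] map_cong step)
  also have "\<dots> = (\<Sum>l'<r k. partial_tt r T k (ix @ [l']) * T (Suc k) [l', i, l])"
    unfolding tt last sum_list_mult_const ..
  finally show ?thesis .
qed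

lemma tt_coeffs_carrier: "tt_coeffs \<psi> r T k \<in> carrier_mat (length (product_basis \<psi> k)) (r k)"
  using unfolding_mat_last_carrier[of "mode_dims \<psi> k"] by (simp add: tt_coeffs_def)

lemma index_tt_coeffs:
  assumes "i < length (product_basis \<psi> k)" "l < r k"
  shows "tt_coeffs \<psi> r T k $$ (i, l) = partial_tt r T k (multi_indices (mode_dims \<psi> k) ! i @ [l])"
  using index_unfolding_mat_last[of i "mode_dims \<psi> k" l "r k"] assms by (simp add: tt_coeffs_def)

lemma tt_coeffs_0:
  assumes "r 0 = 1"
  shows "tt_coeffs \<psi> r T 0 = 1\<^sub>m 1"
  by (rule eq_matI) (simp_all add: assms tt_coeffs_def unfolding_mat_def mode_dims_def
      multi_indices_single partial_tt_def)

text \<open>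
  The previous lemma in matrix form: since the coefficient matrix carries the old mode indices along
  unchanged next to the new one, contracting with a core is multiplication by \<open>B\<^sub>k \<otimes> Id\<close>.
\<close>

lemma tt_coeffs_Suc:
  assumes r0: "r 0 = 1"
  shows "tt_coeffs \<psi> r T (Suc k) = kron_id (tt_coeffs \<psi> r T k) (length (\<psi> (Suc k))) *
    unfolding_mat [r k, length (\<psi> (Suc k)), r (Suc k)] 2 (T (Suc k))"
proof (rule eq_matI)
  let ?n = "length (\<psi> (Suc k))" and ?N = "length (product_basis \<psi> k)"
  let ?U = "unfolding_mat [r k, ?n, r (Suc k)] 2 (T (Suc k))"
  note B = tt_coeffs_carrier[of \<psi> r T k]
  note K = kron_id_carrier[OF B, of ?n]
  note U = core_unfolding2_carrier[of "r k" ?n "r (Suc k)" "T (Suc k)"]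
  fix i j assume "i < dim_row (kron_id (tt_coeffs \<psi> r T k) ?n * ?U)"
    "j < dim_col (kron_id (tt_coeffs \<psi> r T k) ?n * ?U)"
  then have i: "i < ?N * ?n" and j: "j < r (Suc k)" using K U by auto
  note ib = div_mod_bounds[OF i]
  define ix where "ix = multi_indices (mode_dims \<psi> k) ! (i div ?n)"
  have ix: "length ix = k" using ib by (simp add: ix_def length_nth_multi_indices)
  have "tt_coeffs \<psi> r T (Suc k) $$ (i, j) = partial_tt r T (Suc k) (ix @ [i mod ?n, j])"
    using i j by (simp add: index_tt_coeffs mode_dims_Suc nth_multi_indices_snoc ix_def)
  also have "\<dots> = (\<Sum>l<r k. partial_tt r T k (ix @ [l]) * T (Suc k) [l, i mod ?n, j])"
    by (rule partial_tt_Suc[of r, OF r0 ix])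
  also have "\<dots> = (\<Sum>l<r k. tt_coeffs \<psi> r T k $$ (i div ?n, l) * T (Suc k) [l, i mod ?n, j])"
    using ib by (intro sum.cong) (auto simp: index_tt_coeffs ix_def)
  also have "\<dots> = (\<Sum>l<r k. \<Sum>b<?n.
      if b = i mod ?n then tt_coeffs \<psi> r T k $$ (i div ?n, l) * T (Suc k) [l, b, j] else 0)"
    using ib by simp
  also have "\<dots> = (\<Sum>q<r k * ?n. if q mod ?n = i mod ?n
      then tt_coeffs \<psi> r T k $$ (i div ?n, q div ?n) * T (Suc k) [q div ?n, q mod ?n, j] else 0)"
    by (rule sum_pair_index[symmetric])
  also have "\<dots> = (\<Sum>q<r k * ?n. kron_id (tt_coeffs \<psi> r T k) ?n $$ (i, q) * ?U $$ (q, j))"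
    using i j by (intro sum.cong) (auto simp: index_kron_id[OF B] index_core_unfolding2)
  also have "\<dots> = (kron_id (tt_coeffs \<psi> r T k) ?n * ?U) $$ (i, j)"
    by (rule index_mat_mult_sum[OF K U i j, symmetric])
  finally show "tt_coeffs \<psi> r T (Suc k) $$ (i, j) =
      (kron_id (tt_coeffs \<psi> r T k) ?n * ?U) $$ (i, j)" .
qed (use tt_coeffs_carrier[of \<psi> r T "Suc k"] core_unfolding2_carrier[of "r k" "length (\<psi> (Suc k))" "r (Suc k)" "T (Suc k)"]
    kron_id_carrier[OF tt_coeffs_carrier[of \<psi> r T k], of "length (\<psi> (Suc k))"]
    in \<open>auto simp: mode_dims_Suc\<close>)

lemma data_core_first_unfolding:
  "unfolding_mat [1, length (\<psi> 1), length X] 2 (data_core \<psi> X 1) =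
    eval_mat (vec_tensor [\<lambda>_. 1] (\<psi> 1)) X"
proof (rule eq_matI)
  fix i j assume "i < dim_row (eval_mat (vec_tensor [\<lambda>_. 1] (\<psi> 1)) X)"
    "j < dim_col (eval_mat (vec_tensor [\<lambda>_. 1] (\<psi> 1)) X)"
  then have i: "i < 1 * length (\<psi> 1)" and j: "j < length X" by (auto simp: eval_mat_def)
  show "unfolding_mat [1, length (\<psi> 1), length X] 2 (data_core \<psi> X 1) $$ (i, j) =
      eval_mat (vec_tensor [\<lambda>_. 1] (\<psi> 1)) X $$ (i, j)"
    unfolding index_core_unfolding2[OF i j]
    using i j by (simp add: data_core_def index_eval_mat nth_vec_tensor)
qed (use core_unfolding2_carrier[of 1 "length (\<psi> 1)" "length X" "data_core \<psi> X 1"]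
    in \<open>auto simp: eval_mat_def\<close>)

text \<open>
  Absorbing a factor \<open>\<theta>(X)\<close> into a data core. The core is diagonal in its rank indices, which are
  positions of data points, so the contraction leaves the single term \<open>\<theta>\<^sub>a(x\<^sub>j) \<psi>\<^bsub>k,b\<^esub>(x\<^sub>j)\<close>.
\<close>

lemma data_core_absorb:
  assumes W: "unfolding_mat [length \<theta>, length (\<psi> k), length X] 1 W =
      eval_mat \<theta> X * unfolding_mat [length X, length (\<psi> k), length X] 1 (data_core \<psi> X k)"
    and k: "k \<noteq> 1"
  shows "unfolding_mat [length \<theta>, length (\<psi> k), length X] 2 W = eval_mat (vec_tensor \<theta> (\<psi> k)) X"
proof (rule eq_matI)
  let ?n = "length (\<psi> k)" and ?m = "length X"
  note D = core_unfolding1_carrier[of ?m ?n ?m "data_core \<psi> X k"]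
  fix i j assume "i < dim_row (eval_mat (vec_tensor \<theta> (\<psi> k)) X)"
    "j < dim_col (eval_mat (vec_tensor \<theta> (\<psi> k)) X)"
  then have i: "i < length \<theta> * ?n" and j: "j < ?m" by (auto simp: eval_mat_def)
  define a b where "a = i div ?n" and "b = i mod ?n"
  have ab: "a < length \<theta>" "b < ?n" using div_mod_bounds[OF i] by (auto simp: a_def b_def)
  define q where "q = b * ?m + j"
  have q: "q < ?n * ?m" "q mod ?m = j"
    using pair_index_bound[OF ab(2) j] j by (auto simp: q_def)
  have "?m \<noteq> 0" using j by linarith
  then have "q div ?m = b" using div_mult_self3[of ?m b j] div_less[OF j] by (simp add: q_def)
  note q = q this
  have "W [a, b, j] = unfolding_mat [length \<theta>, ?n, ?m] 1 W $$ (a, q)"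
    using index_core_unfolding1[OF ab(1) q(1), of W] q by simp
  also have "\<dots> = (\<Sum>l<?m. eval_mat \<theta> X $$ (a, l) *
      unfolding_mat [?m, ?n, ?m] 1 (data_core \<psi> X k) $$ (l, q))"
    unfolding W by (rule index_mat_mult_sum[OF eval_mat_carrier D ab(1) q(1)])
  also have "\<dots> = (\<Sum>l<?m. if l = j then (\<theta> ! a) (X ! l) * (\<psi> k ! b) (X ! l) else 0)"
    using k ab q by (intro sum.cong)
      (auto simp: index_core_unfolding1[unfolded One_nat_def] index_eval_mat data_core_def)
  also have "\<dots> = (\<theta> ! a) (X ! j) * (\<psi> k ! b) (X ! j)" using j by simp
  also have "\<dots> = eval_mat (vec_tensor \<theta> (\<psi> k)) X $$ (i, j)"
    using i j by (simp add: index_eval_mat nth_vec_tensor a_def b_def)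
  finally show "unfolding_mat [length \<theta>, ?n, ?m] 2 W $$ (i, j) =
      eval_mat (vec_tensor \<theta> (\<psi> k)) X $$ (i, j)"
    unfolding index_core_unfolding2[OF i j] a_def b_def .
qed (use core_unfolding2_carrier[of "length \<theta>" "length (\<psi> k)" "length X" W]
    in \<open>auto simp: eval_mat_def\<close>)

section \<open>The global SVD as a spectral recursion\<close>

text \<open>
  The global SVD read as a recursion on functions. Each step decomposes the values of
  \<open>vec(\<theta>\<^sub>k \<otimes> \<psi>\<^bsub>k+1\<^esub>)\<close> at the data points, by induction on \<open>k\<close>: what one step hands to the next is
  \<open>\<Sigma> V\<^sup>T = U\<^sup>T A\<close>, that is, the values of the new functions.
\<close>

lemma global_svd_evaluations:
  fixes \<psi> :: "nat \<Rightarrow> ('a \<Rightarrow> real) list"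
  assumes r0: "r 0 = 1" and gsvd: "global_svd \<psi> p r X T S V"
  defines "\<theta> \<equiv> \<lambda>k. fn_mult (product_basis \<psi> k) (tt_coeffs \<psi> r T k)"
  obtains Us Ss Vs where "S = Ss p" "V = Vs p"
    "\<forall>k<p. tt_coeffs \<psi> r T (Suc k) =
      kron_id (tt_coeffs \<psi> r T k) (length (\<psi> (Suc k))) * Us (Suc k)"
    "\<forall>k<p. \<theta> (Suc k) = fn_mult (vec_tensor (\<theta> k) (\<psi> (Suc k))) (Us (Suc k))"
    "\<forall>k<p. truncated_svd (eval_mat (vec_tensor (\<theta> k) (\<psi> (Suc k))) X) (r (Suc k))
      (Us (Suc k)) (Ss (Suc k)) (Vs (Suc k))"
    "\<forall>k<p. Ss (Suc k) * (Vs (Suc k))\<^sup>T = eval_mat (\<theta> (Suc k)) X"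
proof -
  obtain W Us Ss Vs where W1: "W 1 = data_core \<psi> X 1"
    and svd: "\<And>k. k \<in> {1..p} \<Longrightarrow>
      truncated_svd (unfolding_mat [r (k - 1), length (\<psi> k), length X] 2 (W k)) (r k) (Us k) (Ss k) (Vs k)"
    and Us: "\<And>k. k \<in> {1..p} \<Longrightarrow> unfolding_mat [r (k - 1), length (\<psi> k), r k] 2 (T k) = Us k"
    and W: "\<And>k. k \<in> {1..<p} \<Longrightarrow> unfolding_mat [r k, length (\<psi> (k + 1)), length X] 1 (W (k + 1)) =
      Ss k * (Vs k)\<^sup>T * unfolding_mat [length X, length (\<psi> (k + 1)), length X] 1 (data_core \<psi> X (k + 1))"
    and SV_last: "S = Ss p" "V = Vs p"
    using gsvd unfolding global_svd_def Let_def by blast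
  note B = tt_coeffs_carrier[of \<psi> r T]
  have len: "length (\<theta> k) = r k" for k using B[of k] by (simp add: \<theta>_def)
  have U: "Us (Suc k) \<in> carrier_mat (r k * length (\<psi> (Suc k))) (r (Suc k))" if "k < p" for k
    using core_unfolding2_carrier[of "r k" "length (\<psi> (Suc k))" "r (Suc k)" "T (Suc k)"]
      Us[of "Suc k"] that by simp
  have B_Suc: "tt_coeffs \<psi> r T (Suc k) =
      kron_id (tt_coeffs \<psi> r T k) (length (\<psi> (Suc k))) * Us (Suc k)" if "k < p" for k
    using tt_coeffs_Suc[of r \<psi> T k, OF r0] Us[of "Suc k"] that by simp
  have rec: "\<theta> (Suc k) = fn_mult (vec_tensor (\<theta> k) (\<psi> (Suc k))) (Us (Suc k))" if "k < p" for k
  proof -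
    let ?n = "length (\<psi> (Suc k))"
    have K: "kron_id (tt_coeffs \<psi> r T k) ?n \<in>
        carrier_mat (length (vec_tensor (product_basis \<psi> k) (\<psi> (Suc k)))) (r k * ?n)"
      using kron_id_carrier[OF B[of k], of ?n] by simp
    show ?thesis
      unfolding \<theta>_def product_basis_Suc vec_tensor_fn_mult[OF B] B_Suc[OF that]
      by (simp only: fn_mult_fn_mult[OF K U[OF that]])
  qed
  have SV: "Ss (Suc k) * (Vs (Suc k))\<^sup>T = eval_mat (\<theta> (Suc k)) X"
    if k: "k < p" and A: "unfolding_mat [r k, length (\<psi> (Suc k)), length X] 2 (W (Suc k)) =
      eval_mat (vec_tensor (\<theta> k) (\<psi> (Suc k))) X" for k
  proof -
    have "truncated_svd (eval_mat (vec_tensor (\<theta> k) (\<psi> (Suc k))) X) (r (Suc k))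
        (Us (Suc k)) (Ss (Suc k)) (Vs (Suc k))"
      using svd[of "Suc k"] k A by simp
    from truncated_svd_right[OF this]
    show ?thesis using eval_mat_fn_mult[of "Us (Suc k)" "vec_tensor (\<theta> k) (\<psi> (Suc k))" "r (Suc k)" X]
        U[OF k] by (simp add: rec[OF k] len)
  qed
  have A: "unfolding_mat [r k, length (\<psi> (Suc k)), length X] 2 (W (Suc k)) =
      eval_mat (vec_tensor (\<theta> k) (\<psi> (Suc k))) X" if "k < p" for k
    using that
  proof (induction k)
    case 0
    have "tt_coeffs \<psi> r T 0 = 1\<^sub>m (length (product_basis \<psi> 0))"
      using tt_coeffs_0[of r \<psi> T, OF r0] by (simp add: mode_dims_def)
    then have "\<theta> 0 = [\<lambda>_. 1]" by (simp only: \<theta>_def fn_mult_one) (rule product_basis_0)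
    then show ?case using data_core_first_unfolding[of \<psi> X] W1 r0 by simp
  next
    case (Suc k)
    have "unfolding_mat [length (\<theta> (Suc k)), length (\<psi> (Suc (Suc k))), length X] 1 (W (Suc (Suc k))) =
        eval_mat (\<theta> (Suc k)) X *
        unfolding_mat [length X, length (\<psi> (Suc (Suc k))), length X] 1 (data_core \<psi> X (Suc (Suc k)))"
      using W[of "Suc k"] SV[of k] Suc by (simp add: len)
    from data_core_absorb[OF this] show ?case by (simp add: len)
  qed
  have svd_eval: "truncated_svd (eval_mat (vec_tensor (\<theta> k) (\<psi> (Suc k))) X) (r (Suc k))
      (Us (Suc k)) (Ss (Suc k)) (Vs (Suc k))" if "k < p" for k
    using svd[of "Suc k"] A[OF that] that by simp
  show thesis
    using that[of Ss Vs Us] SV_last B_Suc rec svd_eval SV[OF _ A] by blast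
qed

theorem proposition5p10:
  fixes \<psi> :: "nat \<Rightarrow> (real ^ 'd \<Rightarrow> real) list"
    and X :: "(real ^ 'd) list"
    and p :: nat and r :: "nat \<Rightarrow> nat"
    and \<theta>' :: "nat \<Rightarrow> (real ^ 'd \<Rightarrow> real) list"
    and T :: "nat \<Rightarrow> tensor" and S V :: "real mat"
  assumes p: "p \<ge> 1"
    and m: "length X \<ge> 1"
    and r0: "r 0 = 1"
    and r: "\<forall>k\<in>{1..p}. r k \<ge> 1"
    and basis: "\<forall>k\<in>{1..p}. fn_indep (product_basis \<psi> k)"
    and well_defined: "empirical_spectral_bases \<psi> p r X \<theta>'"
    and svd: "global_svd \<psi> p r X T S V"
  shows "(\<forall>k\<in>{1..p}.
            let G = fn_span (set (\<theta>' k));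
                B = coeff_space (product_basis \<psi> k) G;
                \<theta> = fn_mult (product_basis \<psi> k) (tt_coeffs \<psi> r T k)
            in orthonormal_basis (length (product_basis \<psi> k)) (cols (tt_coeffs \<psi> r T k)) B \<and>
               fn_basis \<theta> G)
       \<and> (let \<theta>\<^sub>p = fn_mult (product_basis \<psi> p) (tt_coeffs \<psi> r T p)
          in S * V\<^sup>T = eval_mat \<theta>\<^sub>p X \<and>
             eval_mat \<theta>\<^sub>p X =
               (tt_coeffs \<psi> r T p)\<^sup>T
                 * unfolding_mat (mode_dims \<psi> p @ [length X]) p (data_tensor \<psi> p X))"
proof -
  note B = tt_coeffs_carrier[of \<psi> r T]
  define \<theta> where "\<theta> k = fn_mult (product_basis \<psi> k) (tt_coeffs \<psi> r T k)" for k
  have len: "length (\<theta> k) = r k" for k using B[of k] by (simp add: \<theta>_def)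
  obtain Us Ss Vs where SV: "S = Ss p" "V = Vs p"
    and B_Suc: "\<forall>k<p. tt_coeffs \<psi> r T (Suc k) =
      kron_id (tt_coeffs \<psi> r T k) (length (\<psi> (Suc k))) * Us (Suc k)"
    and rec: "\<forall>k<p. \<theta> (Suc k) = fn_mult (vec_tensor (\<theta> k) (\<psi> (Suc k))) (Us (Suc k))"
    and svd_eval: "\<forall>k<p. truncated_svd (eval_mat (vec_tensor (\<theta> k) (\<psi> (Suc k))) X) (r (Suc k))
      (Us (Suc k)) (Ss (Suc k)) (Vs (Suc k))"
    and SV_eval: "\<forall>k<p. Ss (Suc k) * (Vs (Suc k))\<^sup>T = eval_mat (\<theta> (Suc k)) X"
    using global_svd_evaluations[OF r0 svd] unfolding \<theta>_def by blast
  have U: "Us (Suc k) \<in> carrier_mat (r k * length (\<psi> (Suc k))) (r (Suc k))"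
    and UU: "(Us (Suc k))\<^sup>T * Us (Suc k) = 1\<^sub>m (r (Suc k))" if "k < p" for k
    using truncated_svd_orthonormal(1,2)[OF svd_eval[rule_format, OF that]] by (simp_all add: eval_mat_def len)
  \<comment> \<open>each step multiplies by \<open>B\<^sub>k \<otimes> Id\<close> and by left singular vectors, both with orthonormal columns\<close>
  have gram: "(tt_coeffs \<psi> r T k)\<^sup>T * tt_coeffs \<psi> r T k = 1\<^sub>m (r k)" if "k \<le> p" for k
    using that
  proof (induction k)
    case 0
    then show ?case using r0 by (simp add: tt_coeffs_0[of r \<psi> T, OF r0])
  next
    case (Suc k)
    let ?n = "length (\<psi> (Suc k))"
    show ?case
      using gram_mult[OF kron_id_carrier[OF B[of k], of ?n] U gram_kron_id[OF B[of k], of ?n] UU] Suc B_Suc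
      by simp
  qed
  have spectral: "\<exists>Q \<in> carrier_mat (r k) (r k). Q\<^sup>T * Q = 1\<^sub>m (r k) \<and> length (\<theta>' k) = r k \<and>
      \<theta> k = fn_mult (\<theta>' k) Q" if "k \<le> p" for k
    using that
  proof (induction k)
    case 0
    have "\<theta>' 0 = [\<lambda>_. 1]" using well_defined by (simp add: empirical_spectral_bases_def)
    moreover have "\<theta> 0 = fn_mult [\<lambda>_. 1] (1\<^sub>m 1)"
      by (simp add: \<theta>_def product_basis_0 tt_coeffs_0[of r \<psi> T, OF r0])
    ultimately show ?case using r0 by (intro bexI[of _ "1\<^sub>m 1"]) auto
  next
    case (Suc k)
    then obtain Q where Q: "Q \<in> carrier_mat (r k) (r k)" and QQ: "Q\<^sup>T * Q = 1\<^sub>m (r k)"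
      and len': "length (\<theta>' k) = r k" and \<theta>Q: "\<theta> k = fn_mult (\<theta>' k) Q" by auto
    have k: "k < p" using Suc.prems by simp
    define \<eta> where "\<eta> = vec_tensor (\<theta>' k) (\<psi> (Suc k))"
    let ?n = "length (\<psi> (Suc k))"
    have N: "length \<eta> = r k * ?n" by (simp add: \<eta>_def len')
    obtain U0 where U0: "U0 \<in> carrier_mat (length \<eta>) (r (Suc k))"
      and U0_basis: "orthonormal_basis (length \<eta>) (cols U0)
        (leading_eigenspace (empirical_cov \<eta> X) (r (Suc k)))"
      and \<theta>': "\<theta>' (Suc k) = fn_mult \<eta> U0"
    proof -
      have "Suc k \<in> {1..p}" using k by simp
      then show thesis
        using that well_defined
        unfolding empirical_spectral_bases_def Let_def \<eta>_def by (metis diff_Suc_1)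
    qed
    \<comment> \<open>the discrepancy \<open>Q\<close> of the previous step, acting on the tensor product with \<open>\<psi>\<close>\<close>
    define K where "K = kron_id Q ?n"
    have K: "K \<in> carrier_mat (length \<eta>) (length \<eta>)" and KK: "K\<^sup>T * K = 1\<^sub>m (length \<eta>)"
      using kron_id_carrier[OF Q] gram_kron_id[OF Q QQ] by (simp_all add: K_def N)
    have \<eta>K: "vec_tensor (\<theta> k) (\<psi> (Suc k)) = fn_mult \<eta> K"
      using vec_tensor_fn_mult[of Q "\<theta>' k" "r k" "\<psi> (Suc k)"] Q by (simp add: \<theta>Q len' \<eta>_def K_def)
    obtain R where R: "R \<in> carrier_mat (r (Suc k)) (r (Suc k))" and RR: "R\<^sup>T * R = 1\<^sub>m (r (Suc k))"
      and KU: "K * Us (Suc k) = U0 * R"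
      using leading_singular_vectors_change_of_basis[OF K KK svd_eval[rule_format, OF k, unfolded \<eta>K] U0 U0_basis] .
    have "\<theta> (Suc k) = fn_mult (fn_mult \<eta> K) (Us (Suc k))" using rec k \<eta>K by simp
    also have "\<dots> = fn_mult \<eta> (U0 * R)"
      using fn_mult_fn_mult[OF K, of "Us (Suc k)"] U[OF k] by (simp add: N KU)
    also have "\<dots> = fn_mult (\<theta>' (Suc k)) R" by (simp only: \<theta>' fn_mult_fn_mult[OF U0 R])
    finally show ?case using R RR U0 \<theta>' by auto
  qed
  have part1: "orthonormal_basis (length (product_basis \<psi> k)) (cols (tt_coeffs \<psi> r T k))
        (coeff_space (product_basis \<psi> k) (fn_span (set (\<theta>' k)))) \<and>
      fn_basis (\<theta> k) (fn_span (set (\<theta>' k)))" if k: "k \<in> {1..p}" for k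
  proof -
    have ind: "fn_indep (product_basis \<psi> k)" and kp: "k \<le> p" using basis k by auto
    obtain Q where "Q \<in> carrier_mat (length (\<theta>' k)) (length (\<theta>' k))" "Q\<^sup>T * Q = 1\<^sub>m (length (\<theta>' k))"
      and \<theta>Q: "\<theta> k = fn_mult (\<theta>' k) Q"
      using spectral[OF kp] by auto
    then have span: "fn_span (set (\<theta>' k)) = fn_span (set (\<theta> k))"
      by (simp add: fn_span_fn_mult_orthogonal)
    show ?thesis
      using orthonormal_basis_cols[OF B gram[OF kp]] fn_indep_fn_mult[OF ind B gram[OF kp]]
      unfolding span fn_basis_def \<theta>_def coeff_space_fn_mult[OF ind B] by simp
  qed
  have "S * V\<^sup>T = eval_mat (\<theta> p) X"
    using SV_eval[rule_format, of "p - 1"] p by (simp add: SV)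
  moreover have "eval_mat (\<theta> p) X = (tt_coeffs \<psi> r T p)\<^sup>T
      * unfolding_mat (mode_dims \<psi> p @ [length X]) p (data_tensor \<psi> p X)"
    unfolding \<theta>_def data_tensor_unfolding by (rule eval_mat_fn_mult[OF B])
  ultimately show ?thesis using part1 unfolding Let_def \<theta>_def by blast
qed

end
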